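(* Let $\gamma:I\to\mathbb{G}$ be a unit speed Frenet curve with Frenet-Serret apparatus $\{T,N,B,\kappa,\tau\}$. A unit speed curve $\beta:I\to\mathbb{G}$ with Frenet-Serret apparatus $\{\overline T,\overline N,\overline B,\overline\kappa,\overline\tau\}$ is the natural mate of $\gamma$ if and only if $$\overline T=N,\qquad \overline N=\frac{\Omega^*}{\omega},\qquad \overline B=\frac{\Omega}{\omega},\qquad \overline\kappa=\omega=\kappa\sqrt{1+H^2},\qquad \overline\tau-\overline{\tau_{\mathbb G}}=\frac{\omega}{\sigma}=\frac{H'}{1+H^2},$$ where $\overline{\tau_{\mathbb G}}=\frac12\langle[\overline T,\overline N],\overline B\rangle$.
   Context: Let $\mathbb{G}$ be a three-dimensional Lie group with a bi-invariant Riemannian metric $\langle\cdot,\cdot\rangle$, with (oriented) Lie algebra $\mathfrak g$ and Levi-Civita connection $\nabla$; $I\subset\mathbb R$ is an interval and curves are smooth. Vector fields along a curve in $\mathbb G$ are identified with $\mathfrak g$-valued maps by left translation: fixing an orthonormal basis $X_1,X_2,X_3$ of left-invariant fields, write $U=\sum u_iX_i$, and set $U'=\sum u_i'X_i$, $[U,V]=\sum u_iv_j[X_i,X_j]$; then $\nabla_TU=U'+\frac12[T,U]$ with $T=\gamma'$. Vector fields along different curves with the same parameter interval are compared as $\mathfrak g$-valued maps. A unit speed curve $\gamma$ has Frenet-Serret apparatus $\{T,N,B,\kappa,\tau\}$ if $\kappa=\|\nabla_TT\|>0$, $(T,N,B)$ is a positively oriented orthonormal frame, and $\nabla_TT=\kappa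 N$, $\nabla_TN=-\kappa T+\tau B$, $\nabla_TB=-\tau N$. It is a Frenet curve if moreover $\tau\neq0$. The Lie group torsion is $\tau_{\mathbb G}=\frac12\langle[T,N],B\rangle$; the harmonic curvature is $H=(\tau-\tau_{\mathbb G})/\kappa$. Put $\Omega=(\tau-\tau_{\mathbb G})T+\kappa B$, $\Omega^*=-\kappa T+(\tau-\tau_{\mathbb G})B$, $\omega=\sqrt{(\tau-\tau_{\mathbb G})^2+\kappa^2}$, and $\sigma=\kappa(H^2+1)^{3/2}/H'$; $\omega/\sigma$ is read as $H'/(1+H^2)$ (in particular as $0$ where $H'=0$). A unit speed curve $\beta:I\to\mathbb G$ with Frenet-Serret apparatus $\{\overline T,\overline N,\overline B,\overline\kappa,\overline\tau\}$ is the natural mate of $\gamma$ if $\overline T=N$. *)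

theory Defs
  imports "HOL-Analysis.Analysis" "HOL-Algebra.Group"
begin

text \<open>
  Derivatives are taken within \<open>S\<close>. For open \<open>S\<close> this is the usual notion; for a nondegenerate
  interval it means one-sided derivatives at the endpoints that belong to it.
\<close>

primrec C_k_on ::
  "nat \<Rightarrow> 'a::euclidean_space set \<Rightarrow> ('a \<Rightarrow> 'b::euclidean_space) \<Rightarrow> bool" where
  "C_k_on 0 S f \<longleftrightarrow> continuous_on S f"
| "C_k_on (Suc k) S f \<longleftrightarrow>
     (\<exists>f'. (\<forall>x\<in>S. (f has_derivative f' x) (at x within S)) \<and> (\<forall>v. C_k_on k S (\<lambda>x. f' x v)))"

definition smooth_on :: "'a::euclidean_space set \<Rightarrow> ('a \<Rightarrow> 'b::euclidean_space) \<Rightarrow> bool" where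
  "smooth_on S f \<longleftrightarrow> (\<forall>k. C_k_on k S f)"

text \<open>
  A tangent vector at \<open>p\<close> is a functional on real functions that are smooth near \<open>p\<close>. To make
  equality of tangent vectors plain equality of functions, a functional takes the value 0 on every
  function that is not smooth near \<open>p\<close>.
\<close>

type_synonym 'g chart = "'g set \<times> ('g \<Rightarrow> real^3)"
type_synonym 'g tvec = "('g \<Rightarrow> real) \<Rightarrow> real"
type_synonym 'g vfield = "'g \<Rightarrow> 'g tvec"

record 'g riemannian_group = "'g monoid" +
  atlas :: "'g chart set"
  metric :: "'g \<Rightarrow> 'g tvec \<Rightarrow> 'g tvec \<Rightarrow> real"

definition smooth_atlas :: "'g::topological_space chart set \<Rightarrow> bool" where
  "smooth_atlas \<A> \<longleftrightarrow>
     (\<Union>(U, \<phi>)\<in>\<A>. U) = UNIV \<and>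
     (\<forall>(U, \<phi>)\<in>\<A>. open U \<and> open (\<phi> ` U) \<and> homeomorphism U (\<phi> ` U) \<phi> (inv_into U \<phi>)) \<and>
     (\<forall>(U, \<phi>)\<in>\<A>. \<forall>(V, \<theta>)\<in>\<A>. smooth_on (\<phi> ` (U \<inter> V)) (\<theta> \<circ> inv_into U \<phi>))"

definition smooth_fun_on ::
  "('g::topological_space, 'm) riemannian_group_scheme \<Rightarrow> 'g set \<Rightarrow> ('g \<Rightarrow> real) \<Rightarrow> bool" where
  "smooth_fun_on G S f \<longleftrightarrow>
     (\<forall>(U, \<phi>)\<in>atlas G. smooth_on (\<phi> ` (U \<inter> S)) (f \<circ> inv_into U \<phi>))"

definition smooth_at ::
  "('g::topological_space, 'm) riemannian_group_scheme \<Rightarrow> 'g \<Rightarrow> ('g \<Rightarrow> real) \<Rightarrow> bool" where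
  "smooth_at G p f \<longleftrightarrow> (\<exists>S. open S \<and> p \<in> S \<and> smooth_fun_on G S f)"

definition smooth_curve ::
  "('g::topological_space, 'm) riemannian_group_scheme \<Rightarrow> real set \<Rightarrow> (real \<Rightarrow> 'g) \<Rightarrow> bool" where
  "smooth_curve G I c \<longleftrightarrow>
     continuous_on I c \<and> (\<forall>(U, \<phi>)\<in>atlas G. smooth_on {s\<in>I. c s \<in> U} (\<phi> \<circ> c))"

definition velocity ::
  "('g::topological_space, 'm) riemannian_group_scheme \<Rightarrow> real set \<Rightarrow> (real \<Rightarrow> 'g) \<Rightarrow> real \<Rightarrow> 'g tvec"
  where
  "velocity G I c s =
     (\<lambda>f. if smooth_at G (c s) f then vector_derivative (f \<circ> c) (at s within I) else 0)"

definition tangent_space ::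
  "('g::topological_space, 'm) riemannian_group_scheme \<Rightarrow> 'g \<Rightarrow> 'g tvec set" where
  "tangent_space G p =
     {velocity G {-\<epsilon><..<\<epsilon>} c 0 | \<epsilon> c. \<epsilon> > 0 \<and> smooth_curve G {-\<epsilon><..<\<epsilon>} c \<and> c 0 = p}"

definition vector_field ::
  "('g::topological_space, 'm) riemannian_group_scheme \<Rightarrow> 'g vfield \<Rightarrow> bool" where
  "vector_field G X \<longleftrightarrow>
     (\<forall>p. X p \<in> tangent_space G p) \<and>
     (\<forall>S f. open S \<and> smooth_fun_on G S f \<longrightarrow> smooth_fun_on G S (\<lambda>p. X p f))"

definition lie_bracket ::
  "('g::topological_space, 'm) riemannian_group_scheme \<Rightarrow> 'g vfield \<Rightarrow> 'g vfield \<Rightarrow> 'g vfield" where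
  "lie_bracket G X Y =
     (\<lambda>p f. if smooth_at G p f then X p (\<lambda>q. Y q f) - Y p (\<lambda>q. X q f) else 0)"

definition riemannian_metric ::
  "('g::topological_space, 'm) riemannian_group_scheme \<Rightarrow> bool" where
  "riemannian_metric G \<longleftrightarrow>
     (\<forall>p. \<forall>u\<in>tangent_space G p. \<forall>v\<in>tangent_space G p. \<forall>w\<in>tangent_space G p. \<forall>a b.
        metric G p (\<lambda>f. a * u f + b * v f) w = a * metric G p u w + b * metric G p v w) \<and>
     (\<forall>p. \<forall>v\<in>tangent_space G p. \<forall>w\<in>tangent_space G p. metric G p v w = metric G p w v) \<and>
     (\<forall>p. \<forall>v\<in>tangent_space G p. v \<noteq> (\<lambda>f. 0) \<longrightarrow> metric G p v v > 0) \<and>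
     (\<forall>X Y. vector_field G X \<and> vector_field G Y \<longrightarrow>
        smooth_fun_on G UNIV (\<lambda>p. metric G p (X p) (Y p)))"

definition affine_connection ::
  "('g::topological_space, 'm) riemannian_group_scheme \<Rightarrow> ('g vfield \<Rightarrow> 'g vfield \<Rightarrow> 'g vfield) \<Rightarrow> bool"
  where
  "affine_connection G D \<longleftrightarrow>
     (\<forall>X Y. vector_field G X \<and> vector_field G Y \<longrightarrow> vector_field G (D X Y)) \<and>
     (\<forall>X Y Z h k. vector_field G X \<and> vector_field G Y \<and> vector_field G Z \<and>
        smooth_fun_on G UNIV h \<and> smooth_fun_on G UNIV k \<longrightarrow>
        D (\<lambda>p f. h p * X p f + k p * Y p f) Z = (\<lambda>p f. h p * D X Z p f + k p * D Y Z p f)) \<and>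
     (\<forall>X Y Z. vector_field G X \<and> vector_field G Y \<and> vector_field G Z \<longrightarrow>
        D X (\<lambda>p f. Y p f + Z p f) = (\<lambda>p f. D X Y p f + D X Z p f)) \<and>
     (\<forall>X Y h. vector_field G X \<and> vector_field G Y \<and> smooth_fun_on G UNIV h \<longrightarrow>
        D X (\<lambda>p f. h p * Y p f) = (\<lambda>p f. X p h * Y p f + h p * D X Y p f))"

definition levi_civita ::
  "('g::topological_space, 'm) riemannian_group_scheme \<Rightarrow> ('g vfield \<Rightarrow> 'g vfield \<Rightarrow> 'g vfield) \<Rightarrow> bool"
  where
  "levi_civita G D \<longleftrightarrow>
     affine_connection G D \<and>
     (\<forall>X Y. vector_field G X \<and> vector_field G Y \<longrightarrow>
        (\<lambda>p f. D X Y p f - D Y X p f) = lie_bracket G X Y) \<and>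
     (\<forall>X Y Z p. vector_field G X \<and> vector_field G Y \<and> vector_field G Z \<longrightarrow>
        X p (\<lambda>q. metric G q (Y q) (Z q)) =
          metric G p (D X Y p) (Z p) + metric G p (Y p) (D X Z p))"

definition lie_group_3 ::
  "('g::{t2_space, second_countable_topology}, 'm) riemannian_group_scheme \<Rightarrow> bool" where
  "lie_group_3 G \<longleftrightarrow>
     group G \<and> carrier G = UNIV \<and> smooth_atlas (atlas G) \<and>
     continuous_on UNIV (\<lambda>(x, y). x \<otimes>\<^bsub>G\<^esub> y) \<and>
     (\<forall>(U, \<phi>)\<in>atlas G. \<forall>(V, \<theta>)\<in>atlas G. \<forall>(W, \<psi>)\<in>atlas G.
        smooth_on {(x, y). x \<in> \<phi> ` U \<and> y \<in> \<theta> ` V \<and> inv_into U \<phi> x \<otimes>\<^bsub>G\<^esub> inv_into V \<theta> y \<in> W}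
          (\<lambda>(x, y). \<psi> (inv_into U \<phi> x \<otimes>\<^bsub>G\<^esub> inv_into V \<theta> y))) \<and>
     continuous_on UNIV (\<lambda>x. inv\<^bsub>G\<^esub> x) \<and>
     (\<forall>(U, \<phi>)\<in>atlas G. \<forall>(V, \<theta>)\<in>atlas G.
        smooth_on {x \<in> \<phi> ` U. inv\<^bsub>G\<^esub> (inv_into U \<phi> x) \<in> V} (\<lambda>x. \<theta> (inv\<^bsub>G\<^esub> (inv_into U \<phi> x))))"

text \<open>
  The differentials of left and right translation by \<open>a\<close>. As translations are diffeomorphisms,
  \<open>f\<close> is smooth near \<open>a \<otimes> p\<close> exactly if its composition with the left translation is smooth near
  \<open>p\<close>, so the convention on the value 0 is respected.
\<close>

definition d_left :: "('g, 'm) riemannian_group_scheme \<Rightarrow> 'g \<Rightarrow> 'g tvec \<Rightarrow> 'g tvec" where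
  "d_left G a v = (\<lambda>f. v (\<lambda>p. f (a \<otimes>\<^bsub>G\<^esub> p)))"

definition d_right :: "('g, 'm) riemannian_group_scheme \<Rightarrow> 'g \<Rightarrow> 'g tvec \<Rightarrow> 'g tvec" where
  "d_right G a v = (\<lambda>f. v (\<lambda>p. f (p \<otimes>\<^bsub>G\<^esub> a)))"

definition bi_invariant :: "('g::topological_space, 'm) riemannian_group_scheme \<Rightarrow> bool" where
  "bi_invariant G \<longleftrightarrow>
     (\<forall>a p. \<forall>v\<in>tangent_space G p. \<forall>w\<in>tangent_space G p.
        metric G (a \<otimes>\<^bsub>G\<^esub> p) (d_left G a v) (d_left G a w) = metric G p v w \<and>
        metric G (p \<otimes>\<^bsub>G\<^esub> a) (d_right G a v) (d_right G a w) = metric G p v w)"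

definition left_invariant ::
  "('g::topological_space, 'm) riemannian_group_scheme \<Rightarrow> 'g vfield \<Rightarrow> bool" where
  "left_invariant G X \<longleftrightarrow> vector_field G X \<and> (\<forall>a p. X (a \<otimes>\<^bsub>G\<^esub> p) = d_left G a (X p))"

text \<open>
  An orthonormal basis of the Lie algebra of left-invariant fields. It also carries the orientation:
  the Lie algebra is oriented by declaring the basis positive.
\<close>

definition orthonormal_left_invariant_basis ::
  "('g::topological_space, 'm) riemannian_group_scheme \<Rightarrow> (3 \<Rightarrow> 'g vfield) \<Rightarrow> bool" where
  "orthonormal_left_invariant_basis G E \<longleftrightarrow>
     (\<forall>i. left_invariant G (E i)) \<and>
     (\<forall>p i j. metric G p (E i p) (E j p) = (if i = j then 1 else 0))"

text \<open>
  The vector \<open>u :: real^3\<close> stands for the left-invariant field with coordinates \<open>u\<close> in the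
  basis \<open>E\<close>. As \<open>E\<close> is orthonormal, the metric becomes the standard inner product.
\<close>

definition coords ::
  "('g, 'm) riemannian_group_scheme \<Rightarrow> (3 \<Rightarrow> 'g vfield) \<Rightarrow> 'g \<Rightarrow> 'g tvec \<Rightarrow> real^3" where
  "coords G E p v = (\<chi> k. metric G p v (E k p))"

definition algebra_bracket ::
  "('g::topological_space, 'm) riemannian_group_scheme \<Rightarrow> (3 \<Rightarrow> 'g vfield) \<Rightarrow>
    real^3 \<Rightarrow> real^3 \<Rightarrow> real^3" where
  "algebra_bracket G E u v =
     (\<Sum>i\<in>UNIV. \<Sum>j\<in>UNIV. (u $ i * v $ j) *\<^sub>R coords G E \<one>\<^bsub>G\<^esub> (lie_bracket G (E i) (E j) \<one>\<^bsub>G\<^esub>))"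

definition left_velocity ::
  "('g::topological_space, 'm) riemannian_group_scheme \<Rightarrow> (3 \<Rightarrow> 'g vfield) \<Rightarrow>
    real set \<Rightarrow> (real \<Rightarrow> 'g) \<Rightarrow> real \<Rightarrow> real^3" where
  "left_velocity G E I c s = coords G E (c s) (velocity G I c s)"

text \<open>
  The covariant derivative along \<open>c\<close> induced by a connection \<open>D\<close>: if the field is
  \<open>\<Sum>i. u\<^sub>i X\<^sub>i\<close> and \<open>c' = \<Sum>j. t\<^sub>j X\<^sub>j\<close>, it is
  \<open>\<Sum>i. u\<^sub>i' X\<^sub>i + \<Sum>i j. t\<^sub>j u\<^sub>i D X\<^sub>j X\<^sub>i\<close>.
\<close>

definition cov_deriv ::
  "('g::topological_space, 'm) riemannian_group_scheme \<Rightarrow> ('g vfield \<Rightarrow> 'g vfield \<Rightarrow> 'g vfield) \<Rightarrow>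
    (3 \<Rightarrow> 'g vfield) \<Rightarrow> real set \<Rightarrow> (real \<Rightarrow> 'g) \<Rightarrow> (real \<Rightarrow> real^3) \<Rightarrow> real \<Rightarrow> real^3" where
  "cov_deriv G D E I c u s =
     vector_derivative u (at s within I) +
     (\<Sum>i\<in>UNIV. \<Sum>j\<in>UNIV. (left_velocity G E I c s $ j * u s $ i) *\<^sub>R
        coords G E (c s) (D (E j) (E i) (c s)))"

definition unit_speed_curve ::
  "('g::topological_space, 'm) riemannian_group_scheme \<Rightarrow> real set \<Rightarrow> (real \<Rightarrow> 'g) \<Rightarrow> bool" where
  "unit_speed_curve G I c \<longleftrightarrow>
     smooth_curve G I c \<and> (\<forall>s\<in>I. metric G (c s) (velocity G I c s) (velocity G I c s) = 1)"

definition pos_orthonormal_frame :: "real^3 \<Rightarrow> real^3 \<Rightarrow> real^3 \<Rightarrow> bool" where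
  "pos_orthonormal_frame x y z \<longleftrightarrow>
     norm x = 1 \<and> norm y = 1 \<and> norm z = 1 \<and> x \<bullet> y = 0 \<and> x \<bullet> z = 0 \<and> y \<bullet> z = 0 \<and>
     det (vector [x, y, z] :: real^3^3) > 0"

definition frenet_apparatus ::
  "('g::topological_space, 'm) riemannian_group_scheme \<Rightarrow> ('g vfield \<Rightarrow> 'g vfield \<Rightarrow> 'g vfield) \<Rightarrow>
    (3 \<Rightarrow> 'g vfield) \<Rightarrow> real set \<Rightarrow> (real \<Rightarrow> 'g) \<Rightarrow>
    (real \<Rightarrow> real^3) \<Rightarrow> (real \<Rightarrow> real^3) \<Rightarrow> (real \<Rightarrow> real^3) \<Rightarrow> (real \<Rightarrow> real) \<Rightarrow> (real \<Rightarrow> real) \<Rightarrow> bool"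
  where
  "frenet_apparatus G D E I c T N B \<kappa> \<tau> \<longleftrightarrow>
     unit_speed_curve G I c \<and> smooth_on I T \<and> smooth_on I N \<and> smooth_on I B \<and>
     (\<forall>s\<in>I. T s = left_velocity G E I c s \<and>
        \<kappa> s = norm (cov_deriv G D E I c T s) \<and> \<kappa> s > 0 \<and>
        pos_orthonormal_frame (T s) (N s) (B s) \<and>
        cov_deriv G D E I c T s = \<kappa> s *\<^sub>R N s \<and>
        cov_deriv G D E I c N s = - \<kappa> s *\<^sub>R T s + \<tau> s *\<^sub>R B s \<and>
        cov_deriv G D E I c B s = - \<tau> s *\<^sub>R N s)"

definition frenet_curve ::
  "('g::topological_space, 'm) riemannian_group_scheme \<Rightarrow> ('g vfield \<Rightarrow> 'g vfield \<Rightarrow> 'g vfield) \<Rightarrow>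
    (3 \<Rightarrow> 'g vfield) \<Rightarrow> real set \<Rightarrow> (real \<Rightarrow> 'g) \<Rightarrow>
    (real \<Rightarrow> real^3) \<Rightarrow> (real \<Rightarrow> real^3) \<Rightarrow> (real \<Rightarrow> real^3) \<Rightarrow> (real \<Rightarrow> real) \<Rightarrow> (real \<Rightarrow> real) \<Rightarrow> bool"
  where
  "frenet_curve G D E I c T N B \<kappa> \<tau> \<longleftrightarrow>
     frenet_apparatus G D E I c T N B \<kappa> \<tau> \<and> (\<forall>s\<in>I. \<tau> s \<noteq> 0)"

definition lie_torsion ::
  "('g::topological_space, 'm) riemannian_group_scheme \<Rightarrow> (3 \<Rightarrow> 'g vfield) \<Rightarrow>
    (real \<Rightarrow> real^3) \<Rightarrow> (real \<Rightarrow> real^3) \<Rightarrow> (real \<Rightarrow> real^3) \<Rightarrow> real \<Rightarrow> real" where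
  "lie_torsion G E T N B s = 1/2 * (algebra_bracket G E (T s) (N s) \<bullet> B s)"

text \<open>
  From here on \<open>\<tau>G\<close> is the Lie group torsion of the curve, and \<open>I\<close> is its parameter interval.
\<close>

definition harmonic_curvature ::
  "(real \<Rightarrow> real) \<Rightarrow> (real \<Rightarrow> real) \<Rightarrow> (real \<Rightarrow> real) \<Rightarrow> real \<Rightarrow> real" where
  "harmonic_curvature \<kappa> \<tau> \<tau>G s = (\<tau> s - \<tau>G s) / \<kappa> s"

definition darboux_vec ::
  "(real \<Rightarrow> real^3) \<Rightarrow> (real \<Rightarrow> real^3) \<Rightarrow> (real \<Rightarrow> real) \<Rightarrow> (real \<Rightarrow> real) \<Rightarrow> (real \<Rightarrow> real) \<Rightarrow>
    real \<Rightarrow> real^3" where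
  "darboux_vec T B \<kappa> \<tau> \<tau>G s = (\<tau> s - \<tau>G s) *\<^sub>R T s + \<kappa> s *\<^sub>R B s"

definition darboux_vec_star ::
  "(real \<Rightarrow> real^3) \<Rightarrow> (real \<Rightarrow> real^3) \<Rightarrow> (real \<Rightarrow> real) \<Rightarrow> (real \<Rightarrow> real) \<Rightarrow> (real \<Rightarrow> real) \<Rightarrow>
    real \<Rightarrow> real^3" where
  "darboux_vec_star T B \<kappa> \<tau> \<tau>G s = - \<kappa> s *\<^sub>R T s + (\<tau> s - \<tau>G s) *\<^sub>R B s"

definition darboux_norm ::
  "(real \<Rightarrow> real) \<Rightarrow> (real \<Rightarrow> real) \<Rightarrow> (real \<Rightarrow> real) \<Rightarrow> real \<Rightarrow> real" where
  "darboux_norm \<kappa> \<tau> \<tau>G s = sqrt ((\<tau> s - \<tau>G s)\<^sup>2 + (\<kappa> s)\<^sup>2)"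

definition harmonic_curvature_deriv ::
  "real set \<Rightarrow> (real \<Rightarrow> real) \<Rightarrow> (real \<Rightarrow> real) \<Rightarrow> (real \<Rightarrow> real) \<Rightarrow> real \<Rightarrow> real" where
  "harmonic_curvature_deriv I \<kappa> \<tau> \<tau>G s =
     vector_derivative (harmonic_curvature \<kappa> \<tau> \<tau>G) (at s within I)"

text \<open>
  Where \<open>H' = 0\<close> this is 0 because of \<open>x / 0 = 0\<close>. The quotient of \<open>darboux_norm\<close> by it is then
  0 as well, as it should be.
\<close>

definition sigma_fun ::
  "real set \<Rightarrow> (real \<Rightarrow> real) \<Rightarrow> (real \<Rightarrow> real) \<Rightarrow> (real \<Rightarrow> real) \<Rightarrow> real \<Rightarrow> real" where
  "sigma_fun I \<kappa> \<tau> \<tau>G s =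
     \<kappa> s * ((harmonic_curvature \<kappa> \<tau> \<tau>G s)\<^sup>2 + 1) powr (3/2) / harmonic_curvature_deriv I \<kappa> \<tau> \<tau>G s"

definition natural_mate ::
  "('g::topological_space, 'm) riemannian_group_scheme \<Rightarrow> ('g vfield \<Rightarrow> 'g vfield \<Rightarrow> 'g vfield) \<Rightarrow>
    (3 \<Rightarrow> 'g vfield) \<Rightarrow> real set \<Rightarrow> (real \<Rightarrow> 'g) \<Rightarrow> (real \<Rightarrow> 'g) \<Rightarrow> bool" where
  "natural_mate G D E I \<gamma> \<beta> \<longleftrightarrow>
     (\<exists>T N B \<kappa> \<tau> T' N' B' \<kappa>' \<tau>'.
        frenet_apparatus G D E I \<gamma> T N B \<kappa> \<tau> \<and>
        frenet_apparatus G D E I \<beta> T' N' B' \<kappa>' \<tau>' \<and>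
        (\<forall>s\<in>I. T' s = N s))"

end

theory Submission
  imports Defs
begin

text \<open>
  The Lie bracket of left-invariant fields disappears from the problem. On a three-dimensional group
  with bi-invariant metric its structure constants in an orthonormal frame are totally
  skew-symmetric, so that the bracket is a constant multiple \<open>c\<close> of the cross product
  (\<open>algebra_bracket_cross\<close>) and the covariant derivative of \<open>U\<close> along a curve with tangent \<open>T\<close> is
  \<open>U' + (c/2) T \<times> U\<close> (\<open>cov_deriv_cross\<close>). For a positively oriented frame, \<open>T \<times> N = B\<close> and
  \<open>T \<times> B = - N\<close>. Hence the Lie group torsion is the constant \<open>c/2\<close>, and the
  coordinates satisfy the ordinary Frenet equations \<open>T' = \<kappa> N\<close>, \<open>N' = - \<kappa> T + \<mu> B\<close>,
  \<open>B' = - \<mu> N\<close> with \<open>\<mu> = \<tau> - c/2\<close> (\<open>frenet_apparatus_euclidean\<close>).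

  What remains is a statement about curves of orthonormal frames in \<open>real^3\<close>. If the tangent of the
  second frame is \<open>N\<close>, then \<open>N'\<close> is at the same time \<open>- \<kappa> T + \<mu> B\<close> and the second curvature times
  the second normal. Length and direction of this vector give curvature, normal and binormal
  of the mate (\<open>euclidean_natural_mate_frame\<close>). Differentiating \<open>\<mu> / \<kappa>\<close>, written as a quotient of inner
  products of frame vectors, gives its torsion (\<open>euclidean_natural_mate_torsion\<close>). A curve determines
  its tangent, and the Frenet equations then determine normal and curvature; so it is immaterial
  which Frenet apparatus witnesses that one curve is the natural mate of the other.

  The main work is the skew symmetry (\<open>structure_constant_ad_skew\<close>). It is obtained from
  \<open>f (x \<cdot> y)\<close> as a function of two points, without exponential map or flows. The derivatives of this
  function in the second and in the first variable are the left-invariant field and its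
  right-invariant counterpart. By symmetry of second derivatives, the bracket at the unit is the
  derivative of the difference of these two fields. Both frames are
  orthonormal, because the metric is invariant on both sides; the matrix between them is orthogonal
  and its derivative at the unit is skew-symmetric.
\<close>

section \<open>Functions of class \<open>C\<^sup>k\<close>\<close>

lemma C_k_on_subset:
  assumes "C_k_on k S f" and "T \<subseteq> S"
  shows "C_k_on k T f"
  using assms(1)
proof (induction k arbitrary: f)
  case 0
  then show ?case using assms(2) by (simp add: continuous_on_subset)
next
  case (Suc k)
  then obtain f' where "\<forall>x\<in>S. (f has_derivative f' x) (at x within S)" "\<forall>v. C_k_on k S (\<lambda>x. f' x v)"
    by auto
  with Suc.IH assms(2) show ?case
    by (auto intro!: exI[of _ f'] intro: has_derivative_subset)
qed

lemma C_k_on_cong: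
  assumes "C_k_on k S f" and "\<And>x. x \<in> S \<Longrightarrow> f x = g x"
  shows "C_k_on k S g"
proof (cases k)
  case 0
  then show ?thesis using assms continuous_on_cong[of S S f g] by simp
next
  case (Suc m)
  then obtain f' where f': "\<forall>x\<in>S. (f has_derivative f' x) (at x within S)" "\<forall>v. C_k_on m S (\<lambda>x. f' x v)"
    using assms by auto
  have "(g has_derivative f' x) (at x within S)" if "x \<in> S" for x
    by (rule has_derivative_transform[OF that _ bspec[OF f'(1) that]]) (use assms(2) in auto)
  then show ?thesis using f' Suc by auto
qed

text \<open>
  On an open set the derivative is unique, so the existential quantifier in the definition can be
  resolved once and for all by the Frechet derivative at the point. The local character of the notion
  and its stability under composition rest on this.
\<close>

lemma C_k_on_Suc_open:
  assumes "open S"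
  shows "C_k_on (Suc k) S f \<longleftrightarrow>
    (\<forall>x\<in>S. f differentiable (at x)) \<and> (\<forall>v. C_k_on k S (\<lambda>x. frechet_derivative f (at x) v))"
    (is "?L \<longleftrightarrow> ?R")
proof
  assume ?L
  then obtain f' where f': "\<forall>x\<in>S. (f has_derivative f' x) (at x within S)" "\<forall>v. C_k_on k S (\<lambda>x. f' x v)"
    by auto
  have d: "(f has_derivative f' x) (at x)" if "x \<in> S" for x
    using f'(1) that assms by (metis at_within_open)
  have "f' x = frechet_derivative f (at x)" if "x \<in> S" for x
    using d[OF that] by (rule frechet_derivative_at)
  then have "C_k_on k S (\<lambda>x. frechet_derivative f (at x) v)" for v
    using C_k_on_cong[OF f'(2)[rule_format, of v]] by simp
  then show ?R using d differentiableI by blast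
next
  assume R: ?R
  show ?L unfolding C_k_on.simps
  proof (intro exI[of _ "\<lambda>x. frechet_derivative f (at x)"] conjI ballI allI)
    fix x assume "x \<in> S"
    then show "(f has_derivative frechet_derivative f (at x)) (at x within S)"
      using R by (meson frechet_derivative_works has_derivative_at_withinI)
  qed (use R in auto)
qed

lemma C_k_on_SucI:
  assumes "open S" and "\<And>x. x \<in> S \<Longrightarrow> (f has_derivative f' x) (at x)" and "\<And>v. C_k_on k S (\<lambda>x. f' x v)"
  shows "C_k_on (Suc k) S f"
  using assms by (auto intro!: exI[of _ f'] intro: has_derivative_at_withinI)

lemma C_k_on_SucD: "C_k_on (Suc k) S f \<Longrightarrow> C_k_on k S f"
proof (induction k arbitrary: f)
  case 0
  then show ?case
    by (auto simp: continuous_on_eq_continuous_within intro: has_derivative_continuous)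
next
  case (Suc k)
  then obtain f' where "\<forall>x\<in>S. (f has_derivative f' x) (at x within S)" "\<forall>v. C_k_on (Suc k) S (\<lambda>x. f' x v)"
    by (metis C_k_on.simps(2))
  then show ?case using Suc.IH by auto
qed

lemma C_k_on_local:
  assumes "open S" and "\<And>x. x \<in> S \<Longrightarrow> \<exists>U. open U \<and> x \<in> U \<and> C_k_on k (S \<inter> U) f"
  shows "C_k_on k S f"
  using assms(2)
proof (induction k arbitrary: f)
  case 0
  show ?case unfolding C_k_on.simps continuous_on_eq_continuous_at[OF \<open>open S\<close>]
  proof
    fix x assume x: "x \<in> S"
    then obtain U where "open U" "x \<in> U" "continuous_on (S \<inter> U) f" using 0 by auto
    then show "isCont f x" using x assms(1) continuous_on_eq_continuous_at[of "S \<inter> U" f] by auto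
  qed
next
  case (Suc k)
  have *: "\<exists>U. open U \<and> x \<in> U \<and> f differentiable (at x) \<and>
      C_k_on k (S \<inter> U) (\<lambda>x. frechet_derivative f (at x) v)" if "x \<in> S" for x v
  proof -
    obtain U where "open U" "x \<in> U" "C_k_on (Suc k) (S \<inter> U) f" using Suc.prems[OF \<open>x \<in> S\<close>] by blast
    then show ?thesis
      using C_k_on_Suc_open[of "S \<inter> U" k f] \<open>open S\<close> \<open>x \<in> S\<close> by (metis Int_iff open_Int)
  qed
  then have "C_k_on k S (\<lambda>x. frechet_derivative f (at x) v)" for v
    by (intro Suc.IH) blast
  then show ?case using * C_k_on_Suc_open[OF \<open>open S\<close>] by blast
qed

lemma C_k_on_const: "C_k_on k S (\<lambda>x. c)"
proof (induction k arbitrary: c)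
  case (Suc k)
  show ?case unfolding C_k_on.simps
    by (intro exI[of _ "\<lambda>x v. 0"] conjI ballI allI Suc) simp
qed simp

lemma C_k_on_linear_comp:
  assumes "bounded_linear L" and "C_k_on k S f"
  shows "C_k_on k S (\<lambda>x. L (f x))"
  using assms(2)
proof (induction k arbitrary: f)
  case 0
  then show ?case using assms(1) by (simp add: bounded_linear.continuous_on)
next
  case (Suc k)
  then obtain f' where f': "\<forall>x\<in>S. (f has_derivative f' x) (at x within S)" "\<forall>v. C_k_on k S (\<lambda>x. f' x v)"
    by auto
  show ?case unfolding C_k_on.simps
    by (intro exI[of _ "\<lambda>x v. L (f' x v)"] conjI ballI allI
        bounded_linear.has_derivative[OF assms(1)] Suc.IH) (use f' in auto)
qed

lemma C_k_on_id: "C_k_on k S (\<lambda>x. x)"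
proof (cases k)
  case (Suc m)
  show ?thesis unfolding Suc C_k_on.simps
    by (intro exI[of _ "\<lambda>x v. v"] conjI ballI allI C_k_on_const) simp
qed simp

lemma C_k_on_add:
  assumes "C_k_on k S f" "C_k_on k S g"
  shows "C_k_on k S (\<lambda>x. f x + g x)"
  using assms
proof (induction k arbitrary: f g)
  case 0
  then show ?case by (simp add: continuous_on_add)
next
  case (Suc k)
  obtain f' where f': "\<forall>x\<in>S. (f has_derivative f' x) (at x within S)" "\<forall>v. C_k_on k S (\<lambda>x. f' x v)"
    using Suc.prems by auto
  obtain g' where g': "\<forall>x\<in>S. (g has_derivative g' x) (at x within S)" "\<forall>v. C_k_on k S (\<lambda>x. g' x v)"
    using Suc.prems by auto
  show ?case unfolding C_k_on.simps
    by (intro exI[of _ "\<lambda>x v. f' x v + g' x v"])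
      (use f' g' Suc.IH in \<open>auto intro!: has_derivative_add\<close>)
qed

lemma C_k_on_sum:
  assumes "finite A" and "\<And>a. a \<in> A \<Longrightarrow> C_k_on k S (f a)"
  shows "C_k_on k S (\<lambda>x. \<Sum>a\<in>A. f a x)"
  using assms by (induction A rule: finite_induct) (auto simp: C_k_on_const C_k_on_add)

lemma C_k_on_scaleR:
  fixes f :: "'a::euclidean_space \<Rightarrow> real"
  assumes "C_k_on k S f" "C_k_on k S g"
  shows "C_k_on k S (\<lambda>x. f x *\<^sub>R g x)"
  using assms
proof (induction k arbitrary: f g)
  case 0
  then show ?case by (simp add: continuous_on_scaleR)
next
  case (Suc k)
  obtain f' where f': "\<forall>x\<in>S. (f has_derivative f' x) (at x within S)" "\<forall>v. C_k_on k S (\<lambda>x. f' x v)"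
    using Suc.prems by auto
  obtain g' where g': "\<forall>x\<in>S. (g has_derivative g' x) (at x within S)" "\<forall>v. C_k_on k S (\<lambda>x. g' x v)"
    using Suc.prems by auto
  have "C_k_on k S f" "C_k_on k S g" using Suc.prems by (auto intro: C_k_on_SucD simp del: C_k_on.simps)
  then show ?case unfolding C_k_on.simps
    by (intro exI[of _ "\<lambda>x v. f x *\<^sub>R g' x v + f' x v *\<^sub>R g x"])
      (use f' g' Suc.IH in \<open>auto intro!: has_derivative_scaleR C_k_on_add\<close>)
qed

lemma C_k_on_Pair:
  assumes "C_k_on k S f" "C_k_on k S g"
  shows "C_k_on k S (\<lambda>x. (f x, g x))"
proof -
  have "bounded_linear (\<lambda>x. (x, 0) :: 'b \<times> 'c)" "bounded_linear (\<lambda>x. (0, x) :: 'b \<times> 'c)"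
    by (auto intro!: bounded_linear_Pair bounded_linear_ident bounded_linear_zero)
  then have "C_k_on k S (\<lambda>x. (f x, 0) + (0, g x))"
    using assms by (intro C_k_on_add) (auto dest: C_k_on_linear_comp)
  then show ?thesis by simp
qed

text \<open>
  The derivative of \<open>g \<circ> f\<close> at \<open>x\<close> in direction \<open>v\<close> is
  \<open>\<Sum>b. (f' x v \<bullet> b) g'(f x) b\<close>, where \<open>b\<close> runs through the standard basis. Each summand
  is a product of a function that is one order less smooth with a composition of lower order, so
  induction on the order applies.
\<close>

lemma C_k_on_compose:
  assumes "open S" "open T" "f ` S \<subseteq> T" and "C_k_on k S f" and "C_k_on k T g"
  shows "C_k_on k S (\<lambda>x. g (f x))"
  using assms(4,5)
proof (induction k arbitrary: g)
  case 0
  then show ?case using assms(3) continuous_on_compose2[of T g S f] by simp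
next
  case (Suc k)
  define f' where "f' x = frechet_derivative f (at x)" for x
  define g' where "g' y = frechet_derivative g (at y)" for y
  have f': "(f has_derivative f' x) (at x)" "\<And>v. C_k_on k S (\<lambda>x. f' x v)" if "x \<in> S" for x
    using that Suc.prems(1) unfolding f'_def C_k_on_Suc_open[OF \<open>open S\<close>]
    by (auto simp: frechet_derivative_works[symmetric])
  have g': "(g has_derivative g' y) (at y)" "\<And>v. C_k_on k T (\<lambda>x. g' x v)" if "y \<in> T" for y
    using that Suc.prems(2) unfolding g'_def C_k_on_Suc_open[OF \<open>open T\<close>]
    by (auto simp: frechet_derivative_works[symmetric])
  show ?case
  proof (cases "S = {}")
    case True
    then show ?thesis using C_k_on_cong[OF C_k_on_const, of S] by blast
  next
    case False
    then obtain x0 where x0: "x0 \<in> S" "f x0 \<in> T" using assms(3) by auto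
    have eq: "g' (f x) (f' x v) = (\<Sum>b\<in>Basis. (f' x v \<bullet> b) *\<^sub>R g' (f x) b)" if "x \<in> S" for x v
    proof -
      have "linear (g' (f x))" using g'(1) assms(3) that has_derivative_linear by blast
      then have "g' (f x) (\<Sum>b\<in>Basis. (f' x v \<bullet> b) *\<^sub>R b) = (\<Sum>b\<in>Basis. (f' x v \<bullet> b) *\<^sub>R g' (f x) b)"
        by (simp add: linear_sum linear_cmul)
      then show ?thesis by (simp add: euclidean_representation)
    qed
    show ?thesis
    proof (rule C_k_on_SucI[OF \<open>open S\<close>])
      fix x assume "x \<in> S"
      then show "((\<lambda>x. g (f x)) has_derivative (\<lambda>v. g' (f x) (f' x v))) (at x)"
        using has_derivative_compose[OF f'(1) g'(1)] assms(3) by blast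
    next
      fix v
      have "C_k_on k S (\<lambda>x. \<Sum>b\<in>Basis. (f' x v \<bullet> b) *\<^sub>R g' (f x) b)"
      proof (intro C_k_on_sum C_k_on_scaleR finite_Basis)
        fix b :: 'b
        show "C_k_on k S (\<lambda>x. f' x v \<bullet> b)"
          by (rule C_k_on_linear_comp[OF bounded_linear_inner_left f'(2)[OF x0(1)]])
        show "C_k_on k S (\<lambda>x. g' (f x) b)"
          by (rule Suc.IH[OF C_k_on_SucD[OF Suc.prems(1)] g'(2)[OF x0(2)]])
      qed
      then show "C_k_on k S (\<lambda>x. g' (f x) (f' x v))"
        by (rule C_k_on_cong) (simp add: eq)
    qed
  qed
qed

lemma smooth_on_subset: "smooth_on S f \<Longrightarrow> T \<subseteq> S \<Longrightarrow> smooth_on T f"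
  unfolding smooth_on_def using C_k_on_subset by blast

lemma smooth_on_cong: "smooth_on S f \<Longrightarrow> (\<And>x. x \<in> S \<Longrightarrow> f x = g x) \<Longrightarrow> smooth_on S g"
  unfolding smooth_on_def using C_k_on_cong by blast

lemma smooth_on_local:
  assumes "open S" and "\<And>x. x \<in> S \<Longrightarrow> \<exists>U. open U \<and> x \<in> U \<and> smooth_on (S \<inter> U) f"
  shows "smooth_on S f"
  unfolding smooth_on_def
proof
  fix k show "C_k_on k S f"
    by (rule C_k_on_local[OF assms(1)]) (use assms(2) in \<open>auto simp: smooth_on_def\<close>)
qed

lemma smooth_on_compose:
  assumes "open S" "open T" "f ` S \<subseteq> T" "smooth_on S f" "smooth_on T g"
  shows "smooth_on S (\<lambda>x. g (f x))"
  using assms C_k_on_compose[of S T f _ g] by (auto simp: smooth_on_def)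

lemma smooth_on_differentiable:
  assumes "open S" "smooth_on S f" "x \<in> S"
  shows "f differentiable (at x)"
  using assms C_k_on_Suc_open[OF assms(1), of 0 f] by (auto simp: smooth_on_def simp del: C_k_on.simps)

lemma smooth_on_const: "smooth_on S (\<lambda>x. c)"
  and smooth_on_id: "smooth_on S (\<lambda>x. x)"
  by (auto simp: smooth_on_def C_k_on_const C_k_on_id)

lemma smooth_on_linear: "bounded_linear L \<Longrightarrow> smooth_on S L"
  using C_k_on_linear_comp[OF _ C_k_on_id] by (auto simp: smooth_on_def)

lemma smooth_on_add: "smooth_on S f \<Longrightarrow> smooth_on S g \<Longrightarrow> smooth_on S (\<lambda>x. f x + g x)"
  by (auto simp: smooth_on_def C_k_on_add)

lemma smooth_on_Pair: "smooth_on S f \<Longrightarrow> smooth_on S g \<Longrightarrow> smooth_on S (\<lambda>x. (f x, g x))"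
  by (auto simp: smooth_on_def C_k_on_Pair)

section \<open>Symmetry of second derivatives\<close>

text \<open>
  The mean value theorem, applied first in direction \<open>w\<close> and then in direction \<open>v\<close>, turns the second
  difference into \<open>t\<^sup>2\<close> times a second derivative at a point near \<open>x\<close>; continuity of the second
  derivative does the rest.
\<close>

lemma second_difference_limit:
  fixes h :: "'a::euclidean_space \<Rightarrow> real"
  assumes S: "open S" "x \<in> S" and h: "C_k_on (Suc (Suc 0)) S h"
  shows "((\<lambda>t. (h (x + t *\<^sub>R w + t *\<^sub>R v) - h (x + t *\<^sub>R w) - h (x + t *\<^sub>R v) + h x) / t\<^sup>2) \<longlongrightarrow>
      frechet_derivative (\<lambda>y. frechet_derivative h (at y) w) (at x) v) (at_right 0)"
proof -
  define h' where "h' y = frechet_derivative h (at y)" for y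
  define h2 where "h2 y = frechet_derivative (\<lambda>y. h' y w) (at y) v" for y
  define q where "q t = (h (x + t *\<^sub>R w + t *\<^sub>R v) - h (x + t *\<^sub>R w) - h (x + t *\<^sub>R v) + h x) / t\<^sup>2" for t
  have h': "(h has_derivative h' y) (at y)" "C_k_on (Suc 0) S (\<lambda>y. h' y w)" if "y \<in> S" for y
    using that h unfolding h'_def C_k_on_Suc_open[OF S(1), of "Suc 0"]
    by (auto simp: frechet_derivative_works[symmetric] simp del: C_k_on.simps)
  have h2: "((\<lambda>y. h' y w) has_derivative frechet_derivative (\<lambda>y. h' y w) (at y)) (at y)"
      "continuous_on S h2" if "y \<in> S" for y
    using that h'(2)[OF that] unfolding C_k_on_Suc_open[OF S(1), of "0"] h2_def
    by (auto simp: frechet_derivative_works[symmetric])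
  have scale: "frechet_derivative (\<lambda>y. h' y w) (at y) (r *\<^sub>R v) = r * h2 y" if "y \<in> S" for y r
    using has_derivative_linear[OF h2(1)[OF that]] by (simp add: h2_def linear_cmul)
  have scale': "h' y (r *\<^sub>R w) = r * h' y w" if "y \<in> S" for y r
    using has_derivative_linear[OF h'(1)[OF that]] by (simp add: linear_cmul)
  have cont: "isCont h2 x" using h2(2) S continuous_on_eq_continuous_at by blast
  have "(q \<longlongrightarrow> h2 x) (at_right 0)"
  proof (rule tendstoI)
    fix e :: real assume "e > 0"
    have "\<forall>\<^sub>F y in nhds x. y \<in> S" using S eventually_nhds by blast
    moreover have "\<forall>\<^sub>F y in nhds x. dist (h2 y) (h2 x) < e"
      using cont \<open>e > 0\<close> unfolding isCont_def tendsto_at_iff_tendsto_nhds by (rule tendstoD)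
    ultimately have "\<forall>\<^sub>F y in nhds x. y \<in> S \<and> dist (h2 y) (h2 x) < e" by (rule eventually_conj)
    then obtain d where d: "d > 0" "\<And>y. dist y x < d \<Longrightarrow> y \<in> S \<and> dist (h2 y) (h2 x) < e"
      unfolding eventually_nhds_metric by blast
    define m where "m = d / (norm w + norm v + 1)"
    have npos: "norm w + norm v + 1 > 0" by (simp add: add_nonneg_pos)
    then have "m > 0" using d by (simp add: m_def)
    have near: "dist (x + r *\<^sub>R w + u *\<^sub>R v) x < d" if "0 \<le> r" "r < m" "0 \<le> u" "u < m" for r u
    proof -
      have "dist (x + r *\<^sub>R w + u *\<^sub>R v) x = norm (r *\<^sub>R w + u *\<^sub>R v)" by (simp add: dist_norm add.assoc)
      also have "\<dots> \<le> r * norm w + u * norm v" using that by (metis abs_of_nonneg norm_scaleR norm_triangle_ineq)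
      also have "\<dots> \<le> m * norm w + m * norm v" using that by (intro add_mono mult_right_mono) auto
      also have "\<dots> < m * (norm w + norm v + 1)" using \<open>m > 0\<close> by (simp add: algebra_simps)
      also have "\<dots> = d" using npos by (simp add: m_def)
      finally show ?thesis .
    qed
    have "dist (q t) (h2 x) < e" if t: "0 < t" "t < m" for t
    proof -
      define p where "p r = h (x + r *\<^sub>R w + t *\<^sub>R v) - h (x + r *\<^sub>R w)" for r
      have inS: "x + r *\<^sub>R w + u *\<^sub>R v \<in> S" if "0 \<le> r" "r \<le> t" "0 \<le> u" "u \<le> t" for r u
        using near[of r u] d(2) that t by auto
      have inS0: "x + r *\<^sub>R w \<in> S" if "0 \<le> r" "r \<le> t" for r
        using inS[of r 0] that t by auto
      have dp: "(p has_real_derivative (h' (x + r *\<^sub>R w + t *\<^sub>R v) w - h' (x + r *\<^sub>R w) w)) (at r)"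
        if "0 \<le> r" "r \<le> t" for r
      proof -
        have 1: "((\<lambda>r. x + r *\<^sub>R w + t *\<^sub>R v) has_derivative (\<lambda>k. k *\<^sub>R w)) (at r)"
          "((\<lambda>r. x + r *\<^sub>R w) has_derivative (\<lambda>k. k *\<^sub>R w)) (at r)"
          by (auto intro!: derivative_eq_intros)
        have "(p has_derivative (\<lambda>k. h' (x + r *\<^sub>R w + t *\<^sub>R v) (k *\<^sub>R w) - h' (x + r *\<^sub>R w) (k *\<^sub>R w))) (at r)"
          unfolding p_def
          by (intro has_derivative_diff has_derivative_compose[OF 1(1)] has_derivative_compose[OF 1(2)]
              h'(1) inS inS0) (use that t in auto)
        moreover have "(\<lambda>k. h' (x + r *\<^sub>R w + t *\<^sub>R v) (k *\<^sub>R w) - h' (x + r *\<^sub>R w) (k *\<^sub>R w)) =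
            (*) (h' (x + r *\<^sub>R w + t *\<^sub>R v) w - h' (x + r *\<^sub>R w) w)"
          using scale'[OF inS] scale'[OF inS0] that t by (auto simp: algebra_simps fun_eq_iff)
        ultimately show ?thesis by (simp add: has_field_derivative_def)
      qed
      obtain r where r: "0 < r" "r < t"
        "p t - p 0 = (t - 0) * (h' (x + r *\<^sub>R w + t *\<^sub>R v) w - h' (x + r *\<^sub>R w) w)"
        using MVT2[OF t(1) dp] by auto
      define p2 where "p2 u = h' (x + r *\<^sub>R w + u *\<^sub>R v) w" for u
      have dp2: "(p2 has_real_derivative h2 (x + r *\<^sub>R w + u *\<^sub>R v)) (at u)" if "0 \<le> u" "u \<le> t" for u
      proof -
        have 1: "((\<lambda>u. x + r *\<^sub>R w + u *\<^sub>R v) has_derivative (\<lambda>k. k *\<^sub>R v)) (at u)"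
          by (auto intro!: derivative_eq_intros)
        have i: "x + r *\<^sub>R w + u *\<^sub>R v \<in> S" using inS[of r u] r that by auto
        have "(p2 has_derivative (\<lambda>k. frechet_derivative (\<lambda>y. h' y w) (at (x + r *\<^sub>R w + u *\<^sub>R v)) (k *\<^sub>R v))) (at u)"
          unfolding p2_def by (rule has_derivative_compose[OF 1 h2(1)[OF i]])
        then show ?thesis unfolding scale[OF i] has_field_derivative_def by (simp add: mult_commute_abs)
      qed
      obtain u where u: "0 < u" "u < t" "p2 t - p2 0 = (t - 0) * h2 (x + r *\<^sub>R w + u *\<^sub>R v)"
        using MVT2[OF t(1) dp2] by auto
      have "q t = (p t - p 0) / t\<^sup>2" by (simp add: p_def q_def algebra_simps)
      also have "p t - p 0 = t * (p2 t - p2 0)" using r(3) by (simp add: p2_def)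
      also have "\<dots> = t\<^sup>2 * h2 (x + r *\<^sub>R w + u *\<^sub>R v)" using u(3) by (simp add: power2_eq_square)
      finally have "q t = h2 (x + r *\<^sub>R w + u *\<^sub>R v)" using t by simp
      then show ?thesis using d(2)[OF near[of r u]] r u t by auto
    qed
    then show "\<forall>\<^sub>F t in at_right 0. dist (q t) (h2 x) < e"
      unfolding eventually_at_right_field using \<open>m > 0\<close> by blast
  qed
  then show ?thesis unfolding q_def h2_def h'_def .
qed

text \<open>
  The second difference is symmetric in \<open>v\<close> and \<open>w\<close>, hence so is its limit.
\<close>

lemma second_derivative_symmetric:
  fixes h :: "'a::euclidean_space \<Rightarrow> real"
  assumes "open S" "x \<in> S" and "C_k_on (Suc (Suc 0)) S h"
  shows "frechet_derivative (\<lambda>y. frechet_derivative h (at y) w) (at x) v =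
    frechet_derivative (\<lambda>y. frechet_derivative h (at y) v) (at x) w"
proof (rule tendsto_unique[OF _ second_difference_limit[OF assms]])
  have eq: "h (x + t *\<^sub>R v + t *\<^sub>R w) - h (x + t *\<^sub>R v) - h (x + t *\<^sub>R w) + h x =
      h (x + t *\<^sub>R w + t *\<^sub>R v) - h (x + t *\<^sub>R w) - h (x + t *\<^sub>R v) + h x" for t
    by (simp add: add.commute add.left_commute)
  show "((\<lambda>t. (h (x + t *\<^sub>R w + t *\<^sub>R v) - h (x + t *\<^sub>R w) - h (x + t *\<^sub>R v) + h x) / t\<^sup>2) \<longlongrightarrow>
      frechet_derivative (\<lambda>y. frechet_derivative h (at y) v) (at x) w) (at_right 0)"
    using second_difference_limit[OF assms, of v w] unfolding eq .
qed simp

section \<open>Charts and smooth functions on a Lie group\<close>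

text \<open>
  Differentiation at \<open>p\<close> in the direction that has the coordinate vector \<open>w\<close> in the chart \<open>c\<close>, with the
  value 0 on functions that are not smooth near \<open>p\<close>, as for the velocity of a curve.
\<close>

definition chart_tvec :: "('g::topological_space, 'm) riemannian_group_scheme \<Rightarrow> 'g chart \<Rightarrow> 'g \<Rightarrow> real^3 \<Rightarrow> 'g tvec"
  where
  "chart_tvec G c p w =
     (\<lambda>f. if smooth_at G p f
           then frechet_derivative (f \<circ> inv_into (fst c) (snd c)) (at (snd c p)) w else 0)"

lemma has_vector_derivative_eventually_eq:
  assumes "(g has_vector_derivative d) (at x)" "\<forall>\<^sub>F y in nhds x. f y = g y"
  shows "(f has_vector_derivative d) (at x)"
  using assms has_vector_derivative_transform_within_open[of g d x _ f]
  unfolding eventually_nhds by metis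

locale lie_group3 =
  fixes G :: "'g::{t2_space, second_countable_topology} riemannian_group"
  assumes lie: "lie_group_3 G"
begin

lemma group: "group G" and carrier: "carrier G = UNIV" and atlas: "smooth_atlas (atlas G)"
  and continuous_mult: "continuous_on UNIV (\<lambda>(x, y). x \<otimes>\<^bsub>G\<^esub> y)"
  using lie by (simp_all only: lie_group_3_def)

lemma smooth_mult_charts:
  assumes "(U, \<phi>) \<in> atlas G" "(V, \<theta>) \<in> atlas G" "(W, \<psi>) \<in> atlas G"
  shows "smooth_on {(x, y). x \<in> \<phi> ` U \<and> y \<in> \<theta> ` V \<and> inv_into U \<phi> x \<otimes>\<^bsub>G\<^esub> inv_into V \<theta> y \<in> W}
       (\<lambda>(x, y). \<psi> (inv_into U \<phi> x \<otimes>\<^bsub>G\<^esub> inv_into V \<theta> y))"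
proof -
  have "\<forall>(U, \<phi>)\<in>atlas G. \<forall>(V, \<theta>)\<in>atlas G. \<forall>(W, \<psi>)\<in>atlas G.
     smooth_on {(x, y). x \<in> \<phi> ` U \<and> y \<in> \<theta> ` V \<and> inv_into U \<phi> x \<otimes>\<^bsub>G\<^esub> inv_into V \<theta> y \<in> W}
       (\<lambda>(x, y). \<psi> (inv_into U \<phi> x \<otimes>\<^bsub>G\<^esub> inv_into V \<theta> y))"
    using lie unfolding lie_group_3_def by (elim conjE) assumption
  from bspec[OF bspec[OF bspec[OF this assms(1), unfolded prod.case] assms(2), unfolded prod.case] assms(3), unfolded prod.case]
  show ?thesis by simp
qed

abbreviation mult (infixl "\<cdot>" 70) where "x \<cdot> y \<equiv> x \<otimes>\<^bsub>G\<^esub> y"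
abbreviation unit ("e") where "e \<equiv> \<one>\<^bsub>G\<^esub>"

lemma group_simps [simp]: "e \<cdot> x = x" "x \<cdot> e = x" "inv\<^bsub>G\<^esub> x \<cdot> x = e" "x \<cdot> inv\<^bsub>G\<^esub> x = e"
  "inv\<^bsub>G\<^esub> x \<cdot> (x \<cdot> y) = y" "x \<cdot> (inv\<^bsub>G\<^esub> x \<cdot> y) = y" "(x \<cdot> y) \<cdot> inv\<^bsub>G\<^esub> y = x" "(x \<cdot> inv\<^bsub>G\<^esub> y) \<cdot> y = x"
proof -
  interpret group G by (rule group)
  have assoc: "x \<cdot> y \<cdot> z = x \<cdot> (y \<cdot> z)" for x y z by (simp add: m_assoc carrier)
  show "e \<cdot> x = x" "x \<cdot> e = x" "inv\<^bsub>G\<^esub> x \<cdot> x = e" "x \<cdot> inv\<^bsub>G\<^esub> x = e" for x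
    by (simp_all add: carrier)
  then show "inv\<^bsub>G\<^esub> x \<cdot> (x \<cdot> y) = y" "x \<cdot> (inv\<^bsub>G\<^esub> x \<cdot> y) = y"
    "(x \<cdot> y) \<cdot> inv\<^bsub>G\<^esub> y = x" "(x \<cdot> inv\<^bsub>G\<^esub> y) \<cdot> y = x"
    by (metis assoc)+
qed

lemma continuous_on_mult:
  assumes "continuous_on A f" "continuous_on A g"
  shows "continuous_on A (\<lambda>x. f x \<cdot> g x)"
  using continuous_on_compose2[OF continuous_mult continuous_on_Pair[OF assms]] by simp

lemma chart_exists: obtains U \<phi> where "(U, \<phi>) \<in> atlas G" "p \<in> U"
proof -
  have "p \<in> (\<Union>(U, \<phi>)\<in>atlas G. U)"
    using atlas unfolding smooth_atlas_def by (elim conjE) simp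
  then show thesis using that by auto
qed

lemma chart:
  assumes "(U, \<phi>) \<in> atlas G"
  shows "open U" "open (\<phi> ` U)" "continuous_on U \<phi>" "continuous_on (\<phi> ` U) (inv_into U \<phi>)"
    "x \<in> U \<Longrightarrow> inv_into U \<phi> (\<phi> x) = x" "y \<in> \<phi> ` U \<Longrightarrow> inv_into U \<phi> y \<in> U"
    "y \<in> \<phi> ` U \<Longrightarrow> \<phi> (inv_into U \<phi> y) = y"
proof -
  have "open U \<and> open (\<phi> ` U) \<and> homeomorphism U (\<phi> ` U) \<phi> (inv_into U \<phi>)"
  proof -
    have "\<forall>(U, \<phi>)\<in>atlas G. open U \<and> open (\<phi> ` U) \<and> homeomorphism U (\<phi> ` U) \<phi> (inv_into U \<phi>)"
      using atlas unfolding smooth_atlas_def by (elim conjE) assumption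
    from bspec[OF this assms, unfolded prod.case] show ?thesis .
  qed
  then show "open U" "open (\<phi> ` U)" "continuous_on U \<phi>" "continuous_on (\<phi> ` U) (inv_into U \<phi>)"
    "x \<in> U \<Longrightarrow> inv_into U \<phi> (\<phi> x) = x" "y \<in> \<phi> ` U \<Longrightarrow> inv_into U \<phi> y \<in> U"
    "y \<in> \<phi> ` U \<Longrightarrow> \<phi> (inv_into U \<phi> y) = y"
    by (auto simp: homeomorphism_def inv_into_into f_inv_into_f)
qed

lemma chart_image:
  assumes "(U, \<phi>) \<in> atlas G"
  shows "\<phi> ` (U \<inter> S) = {y \<in> \<phi> ` U. inv_into U \<phi> y \<in> S}"
  using chart(5-7)[OF assms] by (auto intro!: image_eqI)

lemma open_chart_image:
  assumes "(U, \<phi>) \<in> atlas G" "open S"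
  shows "open (\<phi> ` (U \<inter> S))"
proof -
  have "open (inv_into U \<phi> -` S \<inter> \<phi> ` U)"
    using assms chart(2,4)[OF assms(1)] continuous_on_open_vimage by blast
  moreover have "\<phi> ` (U \<inter> S) = inv_into U \<phi> -` S \<inter> \<phi> ` U"
    unfolding chart_image[OF assms(1)] by auto
  ultimately show ?thesis by simp
qed

lemma smooth_transition:
  assumes "(U, \<phi>) \<in> atlas G" "(V, \<theta>) \<in> atlas G"
  shows "smooth_on (\<phi> ` (U \<inter> V)) (\<lambda>y. \<theta> (inv_into U \<phi> y))"
proof -
  have "\<forall>(U, \<phi>)\<in>atlas G. \<forall>(V, \<theta>)\<in>atlas G. smooth_on (\<phi> ` (U \<inter> V)) (\<theta> \<circ> inv_into U \<phi>)"
    using atlas unfolding smooth_atlas_def by (elim conjE) assumption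
  from bspec[OF bspec[OF this assms(1), unfolded prod.case] assms(2), unfolded prod.case]
  show ?thesis by (simp add: o_def)
qed

lemma smooth_fun_on_chart:
  assumes "smooth_fun_on G S f" "(U, \<phi>) \<in> atlas G"
  shows "smooth_on (\<phi> ` (U \<inter> S)) (\<lambda>y. f (inv_into U \<phi> y))"
  using bspec[OF assms(1)[unfolded smooth_fun_on_def] assms(2)] by (simp add: o_def)

lemma smooth_at_differentiable:
  assumes "smooth_at G p f" "(U, \<phi>) \<in> atlas G" "p \<in> U"
  shows "(f \<circ> inv_into U \<phi>) differentiable (at (\<phi> p))"
proof -
  obtain S where S: "open S" "p \<in> S" "smooth_fun_on G S f" using assms(1) by (auto simp: smooth_at_def)
  show ?thesis unfolding o_def
    by (rule smooth_on_differentiable[OF open_chart_image[OF assms(2) S(1)] smooth_fun_on_chart[OF S(3) assms(2)]])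
      (use S assms in auto)
qed

text \<open>
  In another chart the function becomes \<open>h\<close> composed with a transition map.
\<close>

lemma smooth_fun_on_coordinates:
  assumes "(U, \<phi>) \<in> atlas G" "smooth_on (\<phi> ` U) h"
  shows "smooth_fun_on G U (\<lambda>q. h (\<phi> q))"
  unfolding smooth_fun_on_def
proof safe
  fix V \<theta> assume V: "(V, \<theta>) \<in> atlas G"
  show "smooth_on (\<theta> ` (V \<inter> U)) ((\<lambda>q. h (\<phi> q)) \<circ> inv_into V \<theta>)" unfolding o_def
    by (rule smooth_on_compose[OF open_chart_image[OF V chart(1)[OF assms(1)]] chart(2)[OF assms(1)] _ smooth_transition[OF V assms(1)] assms(2)])
      (use chart(5)[OF V] in auto)
qed

lemma smooth_at_coordinates:
  assumes "(U, \<phi>) \<in> atlas G" "p \<in> U" "bounded_linear h"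
  shows "smooth_at G p (\<lambda>q. h (\<phi> q))"
  using smooth_fun_on_coordinates[OF assms(1) smooth_on_linear[OF assms(3)]] chart(1)[OF assms(1)] assms(2)
  unfolding smooth_at_def by blast

section \<open>Multiplication and translations in charts\<close>

lemma open_mult_domain:
  assumes U: "(U, \<phi>) \<in> atlas G" and V: "(V, \<theta>) \<in> atlas G" and "open S"
  shows "open {(x, y). x \<in> \<phi> ` U \<and> y \<in> \<theta> ` V \<and> inv_into U \<phi> x \<cdot> inv_into V \<theta> y \<in> S}"
proof -
  let ?m = "\<lambda>z. inv_into U \<phi> (fst z) \<cdot> inv_into V \<theta> (snd z)"
  have "continuous_on (\<phi> ` U \<times> \<theta> ` V) ?m"
    by (intro continuous_on_mult continuous_on_compose2[OF chart(4)[OF U]] continuous_on_compose2[OF chart(4)[OF V]]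
        continuous_on_fst continuous_on_snd continuous_on_id) auto
  then have "open (?m -` S \<inter> \<phi> ` U \<times> \<theta> ` V)"
    using continuous_on_open_vimage open_Times chart(2)[OF U] chart(2)[OF V] \<open>open S\<close> by blast
  moreover have "?m -` S \<inter> \<phi> ` U \<times> \<theta> ` V =
      {(x, y). x \<in> \<phi> ` U \<and> y \<in> \<theta> ` V \<and> inv_into U \<phi> x \<cdot> inv_into V \<theta> y \<in> S}" by auto
  ultimately show ?thesis by simp
qed

text \<open>
  Near each point of the domain the product stays in one chart, where the function is the composition
  of its smooth coordinate expression with the coordinate expression of the multiplication. Both the
  smoothness of translations and the second derivatives behind the Lie bracket are read off from
  this function of two variables.
\<close>

lemma smooth_mult:
  assumes U: "(U, \<phi>) \<in> atlas G" and V: "(V, \<theta>) \<in> atlas G" and S: "open S" and f: "smooth_fun_on G S f"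
  shows "smooth_on {(x, y). x \<in> \<phi> ` U \<and> y \<in> \<theta> ` V \<and> inv_into U \<phi> x \<cdot> inv_into V \<theta> y \<in> S}
    (\<lambda>(x, y). f (inv_into U \<phi> x \<cdot> inv_into V \<theta> y))"
proof -
  define m where "m = (\<lambda>(x, y). inv_into U \<phi> x \<cdot> inv_into V \<theta> y)"
  define Z where "Z A = {(x, y). x \<in> \<phi> ` U \<and> y \<in> \<theta> ` V \<and> inv_into U \<phi> x \<cdot> inv_into V \<theta> y \<in> A}" for A
  have openZ: "open (Z A)" if "open A" for A
    unfolding Z_def by (rule open_mult_domain[OF U V that])
  have mZ: "z \<in> Z A \<Longrightarrow> m z \<in> A" "A \<subseteq> A' \<Longrightarrow> Z A \<subseteq> Z A'" for z A A'
    by (auto simp: m_def Z_def)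
  have "smooth_on (Z S) (\<lambda>z. f (m z))"
  proof (rule smooth_on_local)
    show "open (Z S)" by (rule openZ[OF S])
    fix z assume z: "z \<in> Z S"
    obtain W \<rho> where W: "(W, \<rho>) \<in> atlas G" "m z \<in> W" by (rule chart_exists)
    have "smooth_on (Z W) (\<lambda>(x, y). \<rho> (inv_into U \<phi> x \<cdot> inv_into V \<theta> y))"
      unfolding Z_def by (rule smooth_mult_charts[OF U V W(1)])
    then have "smooth_on (Z W) (\<lambda>z. \<rho> (m z))"
      by (rule smooth_on_cong) (auto simp: m_def)
    then have rho: "smooth_on (Z (W \<inter> S)) (\<lambda>z. \<rho> (m z))"
      by (rule smooth_on_subset) (rule mZ(2), simp)
    have opn: "open (Z (W \<inter> S))"
      by (rule openZ) (use S chart(1)[OF W(1)] in auto)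
    have "smooth_on (Z (W \<inter> S)) (\<lambda>z. f (inv_into W \<rho> (\<rho> (m z))))"
      by (rule smooth_on_compose[OF opn open_chart_image[OF W(1) S] _ rho smooth_fun_on_chart[OF f W(1)]])
        (use mZ(1)[of _ "W \<inter> S"] in \<open>auto intro!: imageI\<close>)
    then have "smooth_on (Z (W \<inter> S)) (\<lambda>z. f (m z))"
      by (rule smooth_on_cong) (use chart(5)[OF W(1)] mZ(1)[of _ "W \<inter> S"] in force)
    then have "smooth_on (Z S \<inter> Z (W \<inter> S)) (\<lambda>z. f (m z))" by (rule smooth_on_subset) simp
    moreover have "z \<in> Z (W \<inter> S)" using z W(2) by (auto simp: Z_def m_def)
    ultimately show "\<exists>A. open A \<and> z \<in> A \<and> smooth_on (Z S \<inter> A) (\<lambda>z. f (m z))"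
      using opn by (intro exI[of _ "Z (W \<inter> S)"] conjI)
  qed
  then show ?thesis unfolding Z_def
    by (rule smooth_on_cong) (auto simp: m_def)
qed

lemma open_translates: assumes "open S" shows "open {q. a \<cdot> q \<in> S}" "open {q. q \<cdot> a \<in> S}"
proof -
  have "continuous_on UNIV (\<lambda>q. a \<cdot> q)" "continuous_on UNIV (\<lambda>q. q \<cdot> a)"
    by (rule continuous_on_mult[OF continuous_on_const continuous_on_id]
        continuous_on_mult[OF continuous_on_id continuous_on_const])+
  then show "open {q. a \<cdot> q \<in> S}" "open {q. q \<cdot> a \<in> S}"
    using assms open_vimage[of S] by (auto simp: vimage_def)
qed

text \<open>
  Translation by \<open>a\<close> is multiplication with one argument kept constant.
\<close>

lemma smooth_fun_on_translates:
  assumes S: "open S" and f: "smooth_fun_on G S f"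
  shows "smooth_fun_on G {q. a \<cdot> q \<in> S} (\<lambda>q. f (a \<cdot> q))" (is ?L)
    and "smooth_fun_on G {q. q \<cdot> a \<in> S} (\<lambda>q. f (q \<cdot> a))" (is ?R)
proof -
  obtain U \<phi> where U: "(U, \<phi>) \<in> atlas G" "a \<in> U" by (rule chart_exists)
  show ?L unfolding smooth_fun_on_def
  proof safe
    fix V \<theta> assume V: "(V, \<theta>) \<in> atlas G"
    have "smooth_on (\<theta> ` (V \<inter> {q. a \<cdot> q \<in> S}))
      (\<lambda>y. (\<lambda>(x, y). f (inv_into U \<phi> x \<cdot> inv_into V \<theta> y)) (\<phi> a, y))"
      by (rule smooth_on_compose[OF open_chart_image[OF V open_translates(1)[OF S]] open_mult_domain[OF U(1) V S]
          _ smooth_on_Pair[OF smooth_on_const smooth_on_id] smooth_mult[OF U(1) V S f]])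
        (use U chart(5)[OF U(1)] chart(5)[OF V] in auto)
    then show "smooth_on (\<theta> ` (V \<inter> {q. a \<cdot> q \<in> S})) ((\<lambda>q. f (a \<cdot> q)) \<circ> inv_into V \<theta>)"
      by (rule smooth_on_cong) (use U chart(5)[OF U(1)] in auto)
  qed
  show ?R unfolding smooth_fun_on_def
  proof safe
    fix V \<theta> assume V: "(V, \<theta>) \<in> atlas G"
    have "smooth_on (\<theta> ` (V \<inter> {q. q \<cdot> a \<in> S}))
      (\<lambda>y. (\<lambda>(x, y). f (inv_into V \<theta> x \<cdot> inv_into U \<phi> y)) (y, \<phi> a))"
      by (rule smooth_on_compose[OF open_chart_image[OF V open_translates(2)[OF S]] open_mult_domain[OF V U(1) S]
          _ smooth_on_Pair[OF smooth_on_id smooth_on_const] smooth_mult[OF V U(1) S f]])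
        (use U chart(5)[OF U(1)] chart(5)[OF V] in auto)
    then show "smooth_on (\<theta> ` (V \<inter> {q. q \<cdot> a \<in> S})) ((\<lambda>q. f (q \<cdot> a)) \<circ> inv_into V \<theta>)"
      by (rule smooth_on_cong) (use U chart(5)[OF U(1)] in auto)
  qed
qed

text \<open>
  The inverse translation gives the converse implication. The equivalence is what makes the
  differentials of translations compatible with the value 0 on non-smooth functions.
\<close>

lemma smooth_at_translates:
  shows "smooth_at G p (\<lambda>q. f (a \<cdot> q)) \<longleftrightarrow> smooth_at G (a \<cdot> p) f"
    and "smooth_at G p (\<lambda>q. f (q \<cdot> a)) \<longleftrightarrow> smooth_at G (p \<cdot> a) f"
proof -
  have L: "smooth_at G p (\<lambda>q. f (a \<cdot> q))" if f: "smooth_at G (a \<cdot> p) f" for a p f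
  proof -
    obtain S where S: "open S" "a \<cdot> p \<in> S" "smooth_fun_on G S f"
      using f unfolding smooth_at_def by blast
    then have "p \<in> {q. a \<cdot> q \<in> S}" by simp
    with open_translates(1)[OF S(1)] smooth_fun_on_translates(1)[OF S(1,3)] show ?thesis
      unfolding smooth_at_def by blast
  qed
  have R: "smooth_at G p (\<lambda>q. f (q \<cdot> a))" if f: "smooth_at G (p \<cdot> a) f" for a p f
  proof -
    obtain S where S: "open S" "p \<cdot> a \<in> S" "smooth_fun_on G S f"
      using f unfolding smooth_at_def by blast
    then have "p \<in> {q. q \<cdot> a \<in> S}" by simp
    with open_translates(2)[OF S(1)] smooth_fun_on_translates(2)[OF S(1,3)] show ?thesis
      unfolding smooth_at_def by blast
  qed
  show "smooth_at G p (\<lambda>q. f (a \<cdot> q)) \<longleftrightarrow> smooth_at G (a \<cdot> p) f"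
  proof
    assume "smooth_at G p (\<lambda>q. f (a \<cdot> q))"
    then have "smooth_at G (inv\<^bsub>G\<^esub> a \<cdot> (a \<cdot> p)) (\<lambda>q. f (a \<cdot> q))" by simp
    from L[OF this] show "smooth_at G (a \<cdot> p) f" by simp
  qed (rule L)
  show "smooth_at G p (\<lambda>q. f (q \<cdot> a)) \<longleftrightarrow> smooth_at G (p \<cdot> a) f"
  proof
    assume "smooth_at G p (\<lambda>q. f (q \<cdot> a))"
    then have "smooth_at G (p \<cdot> a \<cdot> inv\<^bsub>G\<^esub> a) (\<lambda>q. f (q \<cdot> a))" by simp
    from R[OF this] show "smooth_at G (p \<cdot> a) f" by simp
  qed (rule R)
qed

section \<open>Tangent vectors in a chart\<close>

lemma chart_chain_rule:
  assumes U: "(U, \<phi>) \<in> atlas G" "c s \<in> U" and "isCont c s"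
    and c: "((\<lambda>t. \<phi> (c t)) has_vector_derivative w) (at s)" and f: "smooth_at G (c s) f"
  shows "((\<lambda>t. f (c t)) has_vector_derivative frechet_derivative (f \<circ> inv_into U \<phi>) (at (\<phi> (c s))) w) (at s)"
proof -
  let ?d = "frechet_derivative (f \<circ> inv_into U \<phi>) (at (\<phi> (c s)))"
  have d: "((f \<circ> inv_into U \<phi>) has_derivative ?d) (at (\<phi> (c s)))"
    using smooth_at_differentiable[OF f U] frechet_derivative_works by blast
  have "((\<lambda>t. (f \<circ> inv_into U \<phi>) (\<phi> (c t))) has_derivative (\<lambda>t. ?d (t *\<^sub>R w))) (at s)"
    using has_derivative_compose[OF c[unfolded has_vector_derivative_def] d] .
  then have 1: "((\<lambda>t. (f \<circ> inv_into U \<phi>) (\<phi> (c t))) has_vector_derivative ?d w) (at s)"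
    using has_derivative_linear[OF d] by (simp add: has_vector_derivative_def linear_cmul)
  have "\<forall>\<^sub>F t in nhds s. c t \<in> U"
    using assms(3) chart(1)[OF U(1)] U(2) unfolding isCont_def tendsto_at_iff_tendsto_nhds
    by (rule topological_tendstoD)
  then have "\<forall>\<^sub>F t in nhds s. f (c t) = (f \<circ> inv_into U \<phi>) (\<phi> (c t))"
    by eventually_elim (simp add: chart(5)[OF U(1)])
  with 1 show ?thesis by (rule has_vector_derivative_eventually_eq)
qed

lemma chart_tvec_velocity:
  assumes "(U, \<phi>) \<in> atlas G" "c s \<in> U" "isCont c s" "((\<lambda>t. \<phi> (c t)) has_vector_derivative w) (at s)"
  shows "chart_tvec G (U, \<phi>) (c s) w =
    (\<lambda>f. if smooth_at G (c s) f then vector_derivative (\<lambda>t. f (c t)) (at s) else 0)"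
  using vector_derivative_at[OF chart_chain_rule[OF assms]]
  by (auto simp: chart_tvec_def fun_eq_iff)

lemma smooth_curve_differentiable:
  assumes c: "smooth_curve G J c" "open J" "s \<in> J" and U: "(U, \<phi>) \<in> atlas G" "c s \<in> U"
  shows "isCont c s" "(\<lambda>t. \<phi> (c t)) differentiable (at s)"
proof -
  have co: "continuous_on J c" using c by (simp add: smooth_curve_def)
  then show "isCont c s" using c continuous_on_eq_continuous_at by blast
  have eq: "{s \<in> J. c s \<in> U} = c -` U \<inter> J" by auto
  have "open {s \<in> J. c s \<in> U}" unfolding eq
    using co c(2) chart(1)[OF U(1)] continuous_on_open_vimage by blast
  moreover have "smooth_on {s \<in> J. c s \<in> U} (\<lambda>t. \<phi> (c t))"
    using bspec[OF conjunct2[OF c(1)[unfolded smooth_curve_def]] U(1)] by (simp add: o_def)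
  ultimately show "(\<lambda>t. \<phi> (c t)) differentiable (at s)"
    using smooth_on_differentiable c(3) U(2) by blast
qed

lemma velocity_open:
  assumes "open J" "s \<in> J"
  shows "velocity G J c s = (\<lambda>f. if smooth_at G (c s) f then vector_derivative (\<lambda>t. f (c t)) (at s) else 0)"
  unfolding velocity_def at_within_open[OF assms(2,1)] o_def ..

text \<open>
  Straight lines in a chart are smooth curves, so every coordinate vector belongs to a tangent vector.
\<close>

lemma coordinate_line:
  assumes U: "(U, \<phi>) \<in> atlas G" "p \<in> U"
  defines "c \<equiv> \<lambda>w t. inv_into U \<phi> (\<phi> p + t *\<^sub>R w)"
  shows "c w 0 = p" "\<forall>\<^sub>F t in nhds 0. \<phi> (c w t) = \<phi> p + t *\<^sub>R w \<and> c w t \<in> U"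
    "isCont (c w) 0" "((\<lambda>t. \<phi> (c w t)) has_vector_derivative w) (at 0)"
    "chart_tvec G (U, \<phi>) p w \<in> tangent_space G p"
proof -
  define l where "l t = \<phi> p + t *\<^sub>R w" for t
  have l: "continuous_on A l" for A unfolding l_def by (intro continuous_intros)
  have "open (l -` (\<phi> ` U))"
    by (rule open_vimage[OF chart(2)[OF U(1)] l])
  moreover have "0 \<in> l -` (\<phi> ` U)" using U(2) by (simp add: l_def)
  ultimately obtain d where d: "d > 0" "\<And>t. \<bar>t\<bar> < d \<Longrightarrow> l t \<in> \<phi> ` U"
    unfolding open_dist by (metis dist_0_norm dist_commute real_norm_def vimageE)
  define J where "J = {-d<..<d}"
  have J: "open J" "0 \<in> J" "\<And>t. t \<in> J \<Longrightarrow> l t \<in> \<phi> ` U" using d by (auto simp: J_def)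
  have cl: "c w t = inv_into U \<phi> (l t)" for t by (simp add: c_def l_def)
  show c0: "c w 0 = p" using U chart(5)[OF U(1)] by (simp add: c_def)
  have cJ: "\<phi> (c w t) = l t \<and> c w t \<in> U" if "t \<in> J" for t
    using J(3)[OF that] chart(6,7)[OF U(1)] by (simp add: cl)
  then show ev: "\<forall>\<^sub>F t in nhds 0. \<phi> (c w t) = \<phi> p + t *\<^sub>R w \<and> c w t \<in> U"
    using J eventually_nhds unfolding l_def by blast
  have cont: "continuous_on J (c w)" unfolding cl
    by (rule continuous_on_compose2[OF chart(4)[OF U(1)] l]) (use J in auto)
  then show cont0: "isCont (c w) 0" using J continuous_on_eq_continuous_at by blast
  have "(l has_vector_derivative w) (at 0)" unfolding l_def by (auto intro!: derivative_eq_intros)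
  moreover have "\<forall>\<^sub>F t in nhds 0. \<phi> (c w t) = l t" using ev by eventually_elim (simp add: l_def)
  ultimately show der: "((\<lambda>t. \<phi> (c w t)) has_vector_derivative w) (at 0)"
    by (rule has_vector_derivative_eventually_eq)
  have "smooth_curve G J (c w)" unfolding smooth_curve_def
  proof (safe intro!: cont)
    fix V \<theta> assume V: "(V, \<theta>) \<in> atlas G"
    have eq: "{s \<in> J. c w s \<in> V} = c w -` V \<inter> J" by auto
    have "open {s \<in> J. c w s \<in> V}" unfolding eq
      using cont J chart(1)[OF V(1)] continuous_on_open_vimage by blast
    moreover have "smooth_on {s \<in> J. c w s \<in> V} l" unfolding l_def
      by (intro smooth_on_add smooth_on_const smooth_on_linear bounded_linear_scaleR_left)
    moreover have "l ` {s \<in> J. c w s \<in> V} \<subseteq> \<phi> ` (U \<inter> V)"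
      unfolding chart_image[OF U(1)] using J(3) by (auto simp: cl)
    ultimately have "smooth_on {s \<in> J. c w s \<in> V} (\<lambda>t. \<theta> (inv_into U \<phi> (l t)))"
      by (intro smooth_on_compose[OF _ open_chart_image[OF U(1) chart(1)[OF V]] _ _ smooth_transition[OF U(1) V]])
    then show "smooth_on {s \<in> J. c w s \<in> V} (\<theta> \<circ> c w)" by (simp add: o_def cl)
  qed
  moreover have "chart_tvec G (U, \<phi>) p w = velocity G J (c w) 0"
    unfolding velocity_open[OF J(1,2)]
    using chart_tvec_velocity[of U \<phi> "c w" 0 w] U c0 cont0 der by simp
  ultimately show "chart_tvec G (U, \<phi>) p w \<in> tangent_space G p"
    unfolding tangent_space_def J_def using c0 d(1) by blast
qed

text \<open>
  A tangent space, defined by velocities of curves, is thereby a linear image of \<open>real^3\<close>. This is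
  how it becomes known to be a vector space of dimension at most three.
\<close>

lemma tangent_space_chart:
  assumes U: "(U, \<phi>) \<in> atlas G" "p \<in> U"
  shows "tangent_space G p = range (chart_tvec G (U, \<phi>) p)"
proof
  show "range (chart_tvec G (U, \<phi>) p) \<subseteq> tangent_space G p" using coordinate_line(5)[OF U] by auto
  show "tangent_space G p \<subseteq> range (chart_tvec G (U, \<phi>) p)"
  proof
    fix v assume "v \<in> tangent_space G p"
    then obtain d c where d: "d > 0" "smooth_curve G {-d<..<d} c" "c 0 = p" "v = velocity G {-d<..<d} c 0"
      unfolding tangent_space_def by blast
    have 0: "0 \<in> {-d<..<d}" using d by auto
    have c: "isCont c 0" "(\<lambda>t. \<phi> (c t)) differentiable (at 0)"
      using smooth_curve_differentiable[OF d(2) open_greaterThanLessThan 0 U(1)] U(2) d(3) by auto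
    obtain w where w: "((\<lambda>t. \<phi> (c t)) has_vector_derivative w) (at 0)"
      using c(2) vector_derivative_works by blast
    have "v = chart_tvec G (U, \<phi>) p w"
      using chart_tvec_velocity[of U \<phi> c 0 w] U d c(1) w velocity_open[of "{-d<..<d}" 0 c] 0 by auto
    then show "v \<in> range (chart_tvec G (U, \<phi>) p)" by blast
  qed
qed

lemma linear_chart_tvec:
  assumes U: "(U, \<phi>) \<in> atlas G" "p \<in> U"
  shows "linear (\<lambda>w. chart_tvec G (U, \<phi>) p w f)"
proof (cases "smooth_at G p f")
  case True
  then show ?thesis
    using linear_frechet_derivative[OF smooth_at_differentiable[OF True U]] by (simp add: chart_tvec_def)
next
  case False
  then show ?thesis by (simp add: chart_tvec_def linear_zero)
qed

lemma tangent_space_combination: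
  assumes "u \<in> tangent_space G p" "v \<in> tangent_space G p"
  shows "(\<lambda>f. a * u f + b * v f) \<in> tangent_space G p"
proof -
  obtain U \<phi> where U: "(U, \<phi>) \<in> atlas G" "p \<in> U" by (rule chart_exists)
  obtain w z where w: "u = chart_tvec G (U, \<phi>) p w" "v = chart_tvec G (U, \<phi>) p z"
    using assms tangent_space_chart[OF U] by auto
  have "(\<lambda>f. a * u f + b * v f) = chart_tvec G (U, \<phi>) p (a *\<^sub>R w + b *\<^sub>R z)"
    unfolding w fun_eq_iff linear_add[OF linear_chart_tvec[OF U]] linear_cmul[OF linear_chart_tvec[OF U]]
    by simp
  then show ?thesis unfolding tangent_space_chart[OF U] by simp
qed

lemma tangent_space_zero: "(\<lambda>f. 0) \<in> tangent_space G p"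
proof -
  obtain U \<phi> where U: "(U, \<phi>) \<in> atlas G" "p \<in> U" by (rule chart_exists)
  have "chart_tvec G (U, \<phi>) p 0 = (\<lambda>f. 0)"
    unfolding fun_eq_iff linear_0[OF linear_chart_tvec[OF U]] by simp
  then show ?thesis unfolding tangent_space_chart[OF U] by (metis rangeI)
qed

lemma tangent_space_sum:
  assumes "finite A" "\<And>i. i \<in> A \<Longrightarrow> v i \<in> tangent_space G p"
  shows "(\<lambda>f. \<Sum>i\<in>A. a i * v i f) \<in> tangent_space G p"
  using assms
proof (induction A rule: finite_induct)
  case empty
  then show ?case by (simp add: tangent_space_zero)
next
  case (insert i A)
  then show ?case using tangent_space_combination[of "v i" p "\<lambda>f. \<Sum>i\<in>A. a i * v i f" "a i" 1] by simp
qed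

lemma tvec_const: assumes "v \<in> tangent_space G p" shows "v (\<lambda>q. r) = 0"
  using assms velocity_open by (auto simp: tangent_space_def)

text \<open>
  Only first derivatives at one point matter, so a curve along which smooth functions are merely
  differentiable at 0 has a tangent vector as well. This covers translated curves without proving
  that they are smooth in every chart.
\<close>

lemma tangent_vectorI:
  assumes c: "isCont c 0" "\<And>f. smooth_at G (c 0) f \<Longrightarrow> (\<lambda>t. f (c t)) differentiable (at (0::real))"
  shows "(\<lambda>f. if smooth_at G (c 0) f then vector_derivative (\<lambda>t. f (c t)) (at 0) else 0) \<in> tangent_space G (c 0)"
proof -
  obtain U \<phi> where U: "(U, \<phi>) \<in> atlas G" "c 0 \<in> U" by (rule chart_exists)
  have "(\<lambda>t. \<phi> (c t) \<bullet> i) differentiable (at 0)" for i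
    by (rule c(2), rule smooth_at_coordinates[OF U]) (simp add: bounded_linear_inner_left)
  then have "(\<lambda>t. \<phi> (c t)) differentiable (at 0)"
    using differentiable_componentwise_within by blast
  then obtain w where w: "((\<lambda>t. \<phi> (c t)) has_vector_derivative w) (at 0)"
    using vector_derivative_works by blast
  show ?thesis unfolding chart_tvec_velocity[OF U c(1) w, symmetric] tangent_space_chart[OF U] by simp
qed

lemma d_left_right_tangent:
  assumes "v \<in> tangent_space G p"
  shows "d_left G a v \<in> tangent_space G (a \<cdot> p)" "d_right G a v \<in> tangent_space G (p \<cdot> a)"
proof -
  obtain d c where d: "d > 0" "smooth_curve G {-d<..<d} c" "c 0 = p" "v = velocity G {-d<..<d} c 0"
    using assms unfolding tangent_space_def by blast
  have 0: "0 \<in> {-d<..<d}" using d by auto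
  have v: "v = (\<lambda>f. if smooth_at G p f then vector_derivative (\<lambda>t. f (c t)) (at 0) else 0)"
    using velocity_open[of "{-d<..<d}" 0 c] 0 d by simp
  obtain U \<phi> where U: "(U, \<phi>) \<in> atlas G" "p \<in> U" by (rule chart_exists)
  have c: "isCont c 0" "(\<lambda>t. \<phi> (c t)) differentiable (at 0)"
    using smooth_curve_differentiable[OF d(2) open_greaterThanLessThan 0 U(1)] U(2) d(3) by auto
  obtain w where w: "((\<lambda>t. \<phi> (c t)) has_vector_derivative w) (at 0)"
    using c(2) vector_derivative_works by blast
  have diff: "(\<lambda>t. f (c t)) differentiable (at 0)" if "smooth_at G p f" for f
    using chart_chain_rule[of U \<phi> c 0 w f] U d(3) c(1) w that differentiableI_vector by auto
  have tr: "isCont (\<lambda>q. a \<cdot> q) x" "isCont (\<lambda>q. q \<cdot> a) x" for x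
    using continuous_on_mult[OF continuous_on_const continuous_on_id, of UNIV a]
      continuous_on_mult[OF continuous_on_id continuous_on_const, of UNIV a]
    by (auto simp: continuous_on_eq_continuous_at)
  have "(\<lambda>t. f (a \<cdot> c t)) differentiable (at 0)" if "smooth_at G (a \<cdot> p) f" for f
    using diff[of "\<lambda>q. f (a \<cdot> q)"] that by (simp add: smooth_at_translates)
  then show "d_left G a v \<in> tangent_space G (a \<cdot> p)"
    using tangent_vectorI[OF isCont_o2[OF c(1) tr(1)]]
    unfolding d_left_def v smooth_at_translates(1) d(3) by blast
  have "(\<lambda>t. f (c t \<cdot> a)) differentiable (at 0)" if "smooth_at G (p \<cdot> a) f" for f
    using diff[of "\<lambda>q. f (q \<cdot> a)"] that by (simp add: smooth_at_translates)
  then show "d_right G a v \<in> tangent_space G (p \<cdot> a)"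
    using tangent_vectorI[OF isCont_o2[OF c(1) tr(2)]]
    unfolding d_right_def v smooth_at_translates(2) d(3) by blast
qed

end

section \<open>Orthonormal left-invariant frames\<close>

locale bi_invariant_group3 = lie_group3 +
  fixes D :: "'a vfield \<Rightarrow> 'a vfield \<Rightarrow> 'a vfield" and E :: "3 \<Rightarrow> 'a vfield"
  assumes metric: "riemannian_metric G" and bi_inv: "bi_invariant G" and levi_civita: "levi_civita G D"
    and basis: "orthonormal_left_invariant_basis G E"
begin

lemma metric_combination:
  assumes "u \<in> tangent_space G p" "v \<in> tangent_space G p" "w \<in> tangent_space G p"
  shows "metric G p (\<lambda>f. a * u f + b * v f) w = a * metric G p u w + b * metric G p v w"
proof -
  have "\<forall>p. \<forall>u\<in>tangent_space G p. \<forall>v\<in>tangent_space G p. \<forall>w\<in>tangent_space G p. \<forall>a b.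
        metric G p (\<lambda>f. a * u f + b * v f) w = a * metric G p u w + b * metric G p v w"
    using metric unfolding riemannian_metric_def by (elim conjE) assumption
  then show ?thesis using assms by blast
qed

lemma metric_sym:
  assumes "v \<in> tangent_space G p" "w \<in> tangent_space G p"
  shows "metric G p v w = metric G p w v"
proof -
  have "\<forall>p. \<forall>v\<in>tangent_space G p. \<forall>w\<in>tangent_space G p. metric G p v w = metric G p w v"
    using metric unfolding riemannian_metric_def by (elim conjE) assumption
  then show ?thesis using assms by blast
qed

lemma metric_zero: "w \<in> tangent_space G p \<Longrightarrow> metric G p (\<lambda>f. 0) w = 0"
  using metric_combination[OF tangent_space_zero tangent_space_zero, of w p 0 0] by simp

lemma metric_sum:
  assumes "finite A" "\<And>i. i \<in> A \<Longrightarrow> v i \<in> tangent_space G p" "w \<in> tangent_space G p"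
  shows "metric G p (\<lambda>f. \<Sum>i\<in>A. a i * v i f) w = (\<Sum>i\<in>A. a i * metric G p (v i) w)"
  using assms(1,2)
proof (induction A rule: finite_induct)
  case empty
  then show ?case by (simp add: metric_zero assms(3))
next
  case (insert i A)
  then show ?case
    using metric_combination[OF _ tangent_space_sum[of A v p a] assms(3), of "v i" "a i" 1] by simp
qed

lemma E_field: "vector_field G (E i)" and E_left: "E i (a \<cdot> p) = d_left G a (E i p)"
  and metric_E: "metric G p (E i p) (E j p) = (if i = j then 1 else 0)"
  using basis by (auto simp: orthonormal_left_invariant_basis_def left_invariant_def)

lemma E_tangent: "E i p \<in> tangent_space G p"
  using E_field unfolding vector_field_def by blast

lemma E_smooth_at: "smooth_at G p f \<Longrightarrow> smooth_at G p (\<lambda>q. E i q f)"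
  using E_field[of i] unfolding vector_field_def smooth_at_def by blast

text \<open>
  Orthonormal vectors are linearly independent, so the coordinate vectors of the frame form a basis of
  \<open>real^3\<close>; \<open>L\<close> is the change of basis.
\<close>

lemma frame_coordinates:
  assumes U: "(U, \<phi>) \<in> atlas G" "p \<in> U" and w: "\<And>k. E k p = chart_tvec G (U, \<phi>) p (w k)"
  obtains L :: "real^3 \<Rightarrow> real^3" where "linear L" "bij L" "\<And>k. L (axis k 1) = w k"
    "\<And>c f. chart_tvec G (U, \<phi>) p (L c) f = (\<Sum>k\<in>UNIV. c $ k * E k p f)"
proof
  define L :: "real^3 \<Rightarrow> real^3" where "L c = (\<Sum>k\<in>UNIV. c $ k *\<^sub>R w k)" for c
  show lin: "linear L"
    unfolding L_def by (rule linearI) (simp_all add: sum.distrib scaleR_left_distrib scaleR_sum_right)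
  show "L (axis k 1) = w k" for k
    by (simp add: L_def axis_def if_distrib[of "\<lambda>r. r *\<^sub>R _"] cong: if_cong)
  show L: "chart_tvec G (U, \<phi>) p (L c) f = (\<Sum>k\<in>UNIV. c $ k * E k p f)" for c f
    by (simp add: L_def w linear_sum[OF linear_chart_tvec[OF U]] linear_cmul[OF linear_chart_tvec[OF U]])
  have "inj L"
  proof (subst linear_injective_0[OF lin], safe)
    fix c assume "L c = 0"
    then have "(\<lambda>f. \<Sum>k\<in>UNIV. c $ k * E k p f) = (\<lambda>f. 0)"
      unfolding fun_eq_iff L[symmetric] by (simp add: linear_0[OF linear_chart_tvec[OF U]])
    then have "(\<Sum>k\<in>UNIV. c $ k * metric G p (E k p) (E j p)) = 0" for j
      using metric_sum[of UNIV "\<lambda>k. E k p" p "E j p" "\<lambda>k. c $ k"] by (simp add: E_tangent metric_zero)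
    then show "c = 0"
      by (simp add: metric_E vec_eq_iff if_distrib[of "\<lambda>r. _ * r"] cong: if_cong)
  qed
  then show "bij L" using lin linear_injective_imp_surjective by (auto simp: bij_def)
qed

lemma E_chart:
  assumes "(U, \<phi>) \<in> atlas G" "p \<in> U"
  obtains w where "\<And>k. E k p = chart_tvec G (U, \<phi>) p (w k)"
proof -
  have "\<forall>k. \<exists>w. E k p = chart_tvec G (U, \<phi>) p w"
    using E_tangent tangent_space_chart[OF assms] by blast
  then show thesis using that by metis
qed

lemma frame_expansion:
  assumes v: "v \<in> tangent_space G p"
  shows "v f = (\<Sum>k\<in>UNIV. metric G p v (E k p) * E k p f)"
proof -
  obtain U \<phi> where U: "(U, \<phi>) \<in> atlas G" "p \<in> U" by (rule chart_exists)
  obtain w where w: "\<And>k. E k p = chart_tvec G (U, \<phi>) p (w k)" using E_chart[OF U] by metis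
  obtain L where L: "bij L" "\<And>c f. chart_tvec G (U, \<phi>) p (L c) f = (\<Sum>k\<in>UNIV. c $ k * E k p f)"
    using frame_coordinates[OF U w] by metis
  obtain z where "v = chart_tvec G (U, \<phi>) p z" using v tangent_space_chart[OF U] by auto
  then obtain c where "v = chart_tvec G (U, \<phi>) p (L c)" using L(1) by (metis bij_pointE)
  then have c: "v = (\<lambda>f. \<Sum>k\<in>UNIV. c $ k * E k p f)" by (simp add: L(2) fun_eq_iff)
  have "metric G p v (E k p) = c $ k" for k
    unfolding c using metric_sum[of UNIV "\<lambda>k. E k p" p "E k p" "\<lambda>k. c $ k"]
    by (simp add: E_tangent metric_E if_distrib[of "\<lambda>r. _ * r"] cong: if_cong)
  then show ?thesis by (simp add: c)
qed

text \<open>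
  The coordinates of the chart, transformed by the inverse of the matrix of the frame.
\<close>

lemma dual_functions:
  obtains x where "\<And>m. smooth_at G p (x m)" "\<And>k m. E k p (x m) = (if k = m then 1 else 0)"
proof -
  obtain U \<phi> where U: "(U, \<phi>) \<in> atlas G" "p \<in> U" by (rule chart_exists)
  obtain w where w: "\<And>k. E k p = chart_tvec G (U, \<phi>) p (w k)" using E_chart[OF U] by metis
  obtain L :: "real^3 \<Rightarrow> real^3" where L: "linear L" "bij L" "\<And>k. L (axis k 1) = w k"
    using frame_coordinates[OF U w] by metis
  define h where "h m y = inv_into UNIV L y $ m" for m y
  have "linear (inv_into UNIV L)" using inj_linear_imp_inv_linear[OF L(1) bij_is_inj[OF L(2)]] .
  then have h: "bounded_linear (h m)" for m unfolding h_def[abs_def]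
    by (intro bounded_linear_compose[OF bounded_linear_vec_nth]) (simp add: linear_linear)
  have hw: "h m (w k) = (if k = m then 1 else 0)" for k m
    using L(2) L(3)[of k, symmetric] by (simp add: h_def bij_is_inj axis_def)
  have sm: "smooth_at G p (\<lambda>q. h m (\<phi> q))" for m by (rule smooth_at_coordinates[OF U h])
  have "E k p (\<lambda>q. h m (\<phi> q)) = (if k = m then 1 else 0)" for k m
  proof -
    have "((\<lambda>q. h m (\<phi> q)) \<circ> inv_into U \<phi> has_derivative h m) (at (\<phi> p))"
    proof (rule has_derivative_transform_within_open[OF _ chart(2)[OF U(1)]])
      show "(h m has_derivative h m) (at (\<phi> p))" by (rule bounded_linear_imp_has_derivative[OF h])
    qed (use U chart(7)[OF U(1)] in auto)
    then show ?thesis using sm hw by (simp add: w chart_tvec_def frechet_derivative_at[symmetric])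
  qed
  with sm show thesis by (rule that)
qed

section \<open>Second derivatives along left and right translations\<close>

text \<open>
  The value of the left-invariant field at \<open>q\<close> and the right translate to \<open>q\<close> of its value at the unit
  are the two partial derivatives of \<open>(x, y) \<mapsto> f (x \<cdot> y)\<close>: moving the second factor near the unit
  gives the former, moving the first factor gives the latter.
\<close>

lemma frame_at_translates:
  assumes U: "(U, \<phi>) \<in> atlas G" "e \<in> U" and w: "E i e = chart_tvec G (U, \<phi>) e w"
    and f: "open S" "smooth_fun_on G S f" and q: "q \<in> U" "q \<in> S"
  defines "F \<equiv> \<lambda>(x, y). f (inv_into U \<phi> x \<cdot> inv_into U \<phi> y)"
  shows "E i q f = frechet_derivative F (at (\<phi> q, \<phi> e)) (0, w)"
    and "d_right G q (E i e) f = frechet_derivative F (at (\<phi> e, \<phi> q)) (w, 0)"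
proof -
  have inv: "inv_into U \<phi> (\<phi> q) = q" "inv_into U \<phi> (\<phi> e) = e" using U q chart(5)[OF U(1)] by auto
  have sm: "smooth_at G q f" using f q unfolding smooth_at_def by blast
  have diff: "F differentiable (at (\<phi> q, \<phi> e))" "F differentiable (at (\<phi> e, \<phi> q))"
    unfolding F_def
    by (rule smooth_on_differentiable[OF open_mult_domain[OF U(1) U(1) f(1)] smooth_mult[OF U(1) U(1) f]];
        use U q inv in simp)+
  have l: "((\<lambda>y. (\<phi> q, y)) has_derivative (\<lambda>v. (0, v))) (at (\<phi> e))"
    "((\<lambda>x. (x, \<phi> q)) has_derivative (\<lambda>v. (v, 0))) (at (\<phi> e))"
    by (auto intro!: derivative_eq_intros)
  have "((\<lambda>y. F (\<phi> q, y)) has_derivative (\<lambda>v. frechet_derivative F (at (\<phi> q, \<phi> e)) (0, v))) (at (\<phi> e))"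
    using has_derivative_compose[OF l(1), of F] diff(1) unfolding frechet_derivative_works by blast
  then have 1: "frechet_derivative (\<lambda>y. F (\<phi> q, y)) (at (\<phi> e)) = (\<lambda>v. frechet_derivative F (at (\<phi> q, \<phi> e)) (0, v))"
    by (rule frechet_derivative_at[symmetric])
  have "((\<lambda>x. F (x, \<phi> q)) has_derivative (\<lambda>v. frechet_derivative F (at (\<phi> e, \<phi> q)) (v, 0))) (at (\<phi> e))"
    using has_derivative_compose[OF l(2), of F] diff(2) unfolding frechet_derivative_works by blast
  then have 2: "frechet_derivative (\<lambda>x. F (x, \<phi> q)) (at (\<phi> e)) = (\<lambda>v. frechet_derivative F (at (\<phi> e, \<phi> q)) (v, 0))"
    by (rule frechet_derivative_at[symmetric])
  have "E i q f = E i e (\<lambda>r. f (q \<cdot> r))" using E_left[of i q e] by (simp add: d_left_def)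
  also have "\<dots> = frechet_derivative (\<lambda>y. F (\<phi> q, y)) (at (\<phi> e)) w"
    using sm by (simp add: w chart_tvec_def smooth_at_translates F_def inv o_def)
  finally show "E i q f = frechet_derivative F (at (\<phi> q, \<phi> e)) (0, w)" by (simp add: 1)
  have "d_right G q (E i e) f = E i e (\<lambda>r. f (r \<cdot> q))" by (simp add: d_right_def)
  also have "\<dots> = frechet_derivative (\<lambda>x. F (x, \<phi> q)) (at (\<phi> e)) w"
    using sm by (simp add: w chart_tvec_def smooth_at_translates F_def inv o_def)
  finally show "d_right G q (E i e) f = frechet_derivative F (at (\<phi> e, \<phi> q)) (w, 0)" by (simp add: 2)
qed

text \<open>
  Along a line through the unit with direction \<open>E\<^sub>j\<close>, differentiating the left-invariant field \<open>E\<^sub>i\<close>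
  gives \<open>E\<^sub>j E\<^sub>i f\<close>, by definition of a field. For the right translates of \<open>E\<^sub>i\<close> the two factors of the
  product change places; since second derivatives are symmetric, the result is \<open>E\<^sub>i E\<^sub>j f\<close>. The
  difference of both is the Lie bracket at the unit.
\<close>

lemma frame_derivatives_along_line:
  assumes U: "(U, \<phi>) \<in> atlas G" "e \<in> U" and w: "\<And>k. E k e = chart_tvec G (U, \<phi>) e (w k)"
    and f: "smooth_at G e f"
  defines "a \<equiv> \<lambda>j s. inv_into U \<phi> (\<phi> e + s *\<^sub>R w j)"
  shows "((\<lambda>s. E i (a j s) f) has_vector_derivative E j e (\<lambda>q. E i q f)) (at 0)"
    and "((\<lambda>s. d_right G (a j s) (E i e) f) has_vector_derivative E i e (\<lambda>q. E j q f)) (at 0)"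
proof -
  obtain S where S: "open S" "e \<in> S" "smooth_fun_on G S f" using f unfolding smooth_at_def by blast
  define F where "F = (\<lambda>(x, y). f (inv_into U \<phi> x \<cdot> inv_into U \<phi> y))"
  define Z where "Z = {(x, y). x \<in> \<phi> ` U \<and> y \<in> \<phi> ` U \<and> inv_into U \<phi> x \<cdot> inv_into U \<phi> y \<in> S}"
  define g where "g v z = frechet_derivative F (at z) v" for v z
  let ?x = "\<phi> e"
  have Z: "open Z" unfolding Z_def by (rule open_mult_domain[OF U(1) U(1) S(1)])
  have inZ: "(?x, ?x) \<in> Z" using U S chart(5)[OF U(1)] by (simp add: Z_def)
  have FZ: "smooth_on Z F" unfolding Z_def F_def by (rule smooth_mult[OF U(1) U(1) S(1,3)])
  have "C_k_on (Suc 0) Z (g v)" for v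
    using FZ C_k_on_Suc_open[OF Z, of "Suc 0" F] unfolding smooth_on_def g_def by blast
  then have dg: "(g v has_derivative frechet_derivative (g v) (at (?x, ?x))) (at (?x, ?x))" for v
    using C_k_on_Suc_open[OF Z, of 0 "g v"] inZ frechet_derivative_works by blast
  note line = coordinate_line[OF U, folded a_def]
  have a: "a j 0 = e" "isCont (a j) 0" for j
    using line(1,3)[of "w j"] by (simp_all add: a_def)
  have ev: "\<forall>\<^sub>F s in nhds 0. \<phi> (a j s) = ?x + s *\<^sub>R w j \<and> a j s \<in> U \<and> a j s \<in> S" for j
  proof -
    have "(a j \<longlongrightarrow> a j 0) (nhds 0)" using a(2) unfolding isCont_def tendsto_at_iff_tendsto_nhds .
    then have "\<forall>\<^sub>F s in nhds 0. a j s \<in> S" using topological_tendstoD S(1,2) a(1) by metis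
    with line(2)[of "w j"] show ?thesis unfolding a_def by eventually_elim auto
  qed
  have chain: "((\<lambda>s. g v (?x + s *\<^sub>R x, ?x + s *\<^sub>R y)) has_vector_derivative
      frechet_derivative (g v) (at (?x, ?x)) (x, y)) (at 0)" for v x y
  proof -
    have l: "((\<lambda>s. (?x + s *\<^sub>R x, ?x + s *\<^sub>R y)) has_derivative (\<lambda>s. s *\<^sub>R (x, y))) (at 0)"
      by (auto intro!: derivative_eq_intros simp: scaleR_prod_def)
    have dg': "(g v has_derivative frechet_derivative (g v) (at (?x, ?x))) (at (?x + 0 *\<^sub>R x, ?x + 0 *\<^sub>R y))"
      using dg by simp
    have "frechet_derivative (g v) (at (?x, ?x)) (r *\<^sub>R (x, y)) =
        r *\<^sub>R frechet_derivative (g v) (at (?x, ?x)) (x, y)" for r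
      by (rule linear_cmul[OF has_derivative_linear[OF dg]])
    then show ?thesis
      using has_derivative_compose[OF l dg'] by (simp add: has_vector_derivative_def)
  qed
  have E1: "((\<lambda>s. E i (a j s) f) has_vector_derivative frechet_derivative (g (0, w i)) (at (?x, ?x)) (w j, 0)) (at 0)" for i j
  proof (rule has_vector_derivative_eventually_eq[OF chain])
    show "\<forall>\<^sub>F s in nhds 0. E i (a j s) f = g (0, w i) (?x + s *\<^sub>R w j, ?x + s *\<^sub>R 0)"
      using ev[of j]
      by eventually_elim (use frame_at_translates(1)[OF U w S(1,3)] in \<open>auto simp: g_def F_def\<close>)
  qed
  have E2: "((\<lambda>s. E i (a j s) f) has_vector_derivative E j e (\<lambda>q. E i q f)) (at 0)" for i j
    using chart_chain_rule[of U \<phi> "a j" 0 "w j" "\<lambda>q. E i q f"] U a line(4)[of "w j"] E_smooth_at[OF f, of i]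
    by (simp add: w[of j] chart_tvec_def a_def)
  then show "((\<lambda>s. E i (a j s) f) has_vector_derivative E j e (\<lambda>q. E i q f)) (at 0)" .
  have "E i e (\<lambda>q. E j q f) = frechet_derivative (g (0, w j)) (at (?x, ?x)) (w i, 0)"
    using vector_derivative_unique_at[OF E2 E1] .
  also have "\<dots> = frechet_derivative (g (w i, 0)) (at (?x, ?x)) (0, w j)"
    unfolding g_def using second_derivative_symmetric[OF Z inZ] FZ unfolding smooth_on_def by blast
  finally have "((\<lambda>s. g (w i, 0) (?x + s *\<^sub>R 0, ?x + s *\<^sub>R w j)) has_vector_derivative E i e (\<lambda>q. E j q f)) (at 0)"
    using chain[of "(w i, 0)" 0 "w j"] by simp
  then show "((\<lambda>s. d_right G (a j s) (E i e) f) has_vector_derivative E i e (\<lambda>q. E j q f)) (at 0)"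
  proof (rule has_vector_derivative_eventually_eq)
    show "\<forall>\<^sub>F s in nhds 0. d_right G (a j s) (E i e) f = g (w i, 0) (?x + s *\<^sub>R 0, ?x + s *\<^sub>R w j)"
      using ev[of j]
      by eventually_elim (use frame_at_translates(2)[OF U w S(1,3)] in \<open>auto simp: g_def F_def\<close>)
  qed
qed

end

section \<open>Skew symmetry of the structure constants\<close>

text \<open>
  A row vector \<open>X\<close> that is multiplied by matrices tending to the identity has the same limit as the
  product. What has to be excluded is that \<open>X\<close> is unbounded: as soon as the matrix differs little from
  the identity, the product controls at least half of \<open>X\<close>.
\<close>

lemma tendsto_of_near_identity:
  fixes X :: "'n::finite \<Rightarrow> 's \<Rightarrow> real"
  assumes P: "\<And>m. ((\<lambda>s. \<Sum>k\<in>UNIV. X k s * M k m s) \<longlongrightarrow> C m) F"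
    and M: "\<And>k m. (M k m \<longlongrightarrow> (if k = m then 1 else 0)) F"
  shows "(X k \<longlongrightarrow> C k) F"
proof -
  define N where "N k m s = M k m s - (if k = m then 1 else 0)" for k m s
  define n where "n s = (\<Sum>k\<in>UNIV. \<bar>X k s\<bar>)" for s
  define K where "K = (\<Sum>m\<in>UNIV. \<bar>C m\<bar> + 1)"
  define P where "P m s = (\<Sum>k\<in>UNIV. X k s * M k m s)" for m s
  have N: "(N k m \<longlongrightarrow> 0) F" for k m
    using tendsto_diff[OF M[of k m] tendsto_const[of "if k = m then 1 else 0"]] by (simp add: N_def[abs_def])
  have X: "X k s = P k s - (\<Sum>j\<in>UNIV. X j s * N j k s)" for k s
  proof -
    have "(\<Sum>j\<in>UNIV. X j s * N j k s) = P k s - (\<Sum>j\<in>UNIV. X j s * (if j = k then 1 else 0))"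
      by (simp add: N_def P_def right_diff_distrib sum_subtractf)
    then show ?thesis by (simp add: if_distrib[of "\<lambda>r. _ * r"] cong: if_cong)
  qed
  have "\<forall>\<^sub>F s in F. \<forall>k m. \<bar>N k m s\<bar> < 1 / (2 * real CARD('n))"
    using tendstoD[OF N, of "1 / (2 * real CARD('n))"] by (intro eventually_all_finite) simp
  moreover have "\<forall>\<^sub>F s in F. \<forall>m. \<bar>P m s\<bar> < \<bar>C m\<bar> + 1"
    using order_tendstoD(2)[OF tendsto_rabs[OF P]] unfolding P_def
    by (intro eventually_all_finite) simp
  ultimately have bound: "\<forall>\<^sub>F s in F. n s \<le> 2 * K"
  proof eventually_elim
    case (elim s)
    have "\<bar>X k s\<bar> \<le> \<bar>C k\<bar> + 1 + n s / (2 * real CARD('n))" for k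
    proof -
      have "\<bar>X j s * N j k s\<bar> \<le> \<bar>X j s\<bar> * (1 / (2 * real CARD('n)))" for j
        unfolding abs_mult using elim(1) by (intro mult_left_mono) (auto intro: less_imp_le)
      then have "(\<Sum>j\<in>UNIV. \<bar>X j s * N j k s\<bar>) \<le> (\<Sum>j\<in>UNIV. \<bar>X j s\<bar> * (1 / (2 * real CARD('n))))"
        by (intro sum_mono)
      then have "\<bar>\<Sum>j\<in>UNIV. X j s * N j k s\<bar> \<le> n s / (2 * real CARD('n))"
        by (rule order_trans[OF sum_abs, THEN order_trans]) (simp add: n_def sum_divide_distrib)
      moreover have "\<bar>P k s\<bar> < \<bar>C k\<bar> + 1" using elim(2) by blast
      ultimately show ?thesis using X[of k s] by linarith
    qed
    then have "n s \<le> (\<Sum>k\<in>UNIV. (\<bar>C k\<bar> + 1) + n s / (2 * real CARD('n)))"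
      unfolding n_def by (intro sum_mono) (simp add: n_def)
    also have "\<dots> = K + n s / 2" by (simp add: sum.distrib K_def)
    finally show "n s \<le> 2 * K" by simp
  qed
  have "((\<lambda>s. \<Sum>j\<in>UNIV. X j s * N j k s) \<longlongrightarrow> 0) F" for k
  proof (rule tendsto_null_sum)
    fix j :: 'n
    have "\<forall>\<^sub>F s in F. norm (X j s * N j k s) \<le> norm (N j k s) * (2 * K)"
      using bound
    proof eventually_elim
      case (elim s)
      have "\<bar>X j s\<bar> \<le> n s" unfolding n_def by (rule member_le_sum) auto
      then have "\<bar>N j k s\<bar> * \<bar>X j s\<bar> \<le> \<bar>N j k s\<bar> * (2 * K)" using elim by (intro mult_left_mono) auto
      then show ?case by (simp add: abs_mult mult.commute)
    qed
    with N show "((\<lambda>s. X j s * N j k s) \<longlongrightarrow> 0) F" by (rule tendsto_0_le)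
  qed
  from tendsto_diff[OF P[of k] this[of k]]
  have "((\<lambda>s. P k s - (\<Sum>j\<in>UNIV. X j s * N j k s)) \<longlongrightarrow> C k - 0) F" unfolding P_def .
  then show ?thesis unfolding X[of k, symmetric] by simp
qed

context bi_invariant_group3
begin

definition structure_constant :: "3 \<Rightarrow> 3 \<Rightarrow> 3 \<Rightarrow> real" where
  "structure_constant j i k = metric G e (lie_bracket G (E j) (E i) e) (E k e)"

lemma connection_tangent: "D (E j) (E i) p \<in> tangent_space G p"
proof -
  have "affine_connection G D" using levi_civita unfolding levi_civita_def by (elim conjE) assumption
  then have "\<forall>X Y. vector_field G X \<and> vector_field G Y \<longrightarrow> vector_field G (D X Y)"
    unfolding affine_connection_def by (elim conjE) assumption
  then show ?thesis using E_field unfolding vector_field_def by blast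
qed

lemma bracket_connection:
  "lie_bracket G (E j) (E i) p = (\<lambda>f. 1 * D (E j) (E i) p f + (- 1) * D (E i) (E j) p f)"
proof -
  have "\<forall>X Y. vector_field G X \<and> vector_field G Y \<longrightarrow>
        (\<lambda>p f. D X Y p f - D Y X p f) = lie_bracket G X Y"
    using levi_civita unfolding levi_civita_def by (elim conjE) assumption
  then have "(\<lambda>p f. D (E j) (E i) p f - D (E i) (E j) p f) = lie_bracket G (E j) (E i)"
    using E_field by blast
  from this[symmetric] show ?thesis by simp
qed

lemma bracket_tangent: "lie_bracket G (E j) (E i) p \<in> tangent_space G p"
  unfolding bracket_connection by (rule tangent_space_combination[OF connection_tangent connection_tangent])

lemma connection_metric:
  "metric G p (D (E j) (E i) p) (E k p) = - metric G p (D (E j) (E k) p) (E i p)"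
proof -
  have "\<forall>X Y Z p. vector_field G X \<and> vector_field G Y \<and> vector_field G Z \<longrightarrow>
        X p (\<lambda>q. metric G q (Y q) (Z q)) =
          metric G p (D X Y p) (Z p) + metric G p (Y p) (D X Z p)"
    using levi_civita unfolding levi_civita_def by (elim conjE) assumption
  then have "E j p (\<lambda>q. metric G q (E i q) (E k q)) =
      metric G p (D (E j) (E i) p) (E k p) + metric G p (E i p) (D (E j) (E k) p)"
    using E_field by blast
  then show ?thesis
    using tvec_const[OF E_tangent] metric_sym[OF E_tangent connection_tangent] by (simp add: metric_E)
qed

text \<open>
  Left-invariant fields commute with left translations, and so do their second derivatives.
\<close>

lemma bracket_left_invariant: "lie_bracket G (E j) (E i) (a \<cdot> p) = d_left G a (lie_bracket G (E j) (E i) p)"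
proof -
  have *: "E j (a \<cdot> p) (\<lambda>q. E i q f) = E j p (\<lambda>q. E i q (\<lambda>r. f (a \<cdot> r)))" for i j f
    by (simp add: E_left d_left_def)
  show ?thesis unfolding lie_bracket_def d_left_def * smooth_at_translates by simp
qed

lemma bracket_coordinates: "metric G p (lie_bracket G (E j) (E i) p) (E k p) = structure_constant j i k"
proof -
  have inv: "metric G (a \<cdot> p) (d_left G a v) (d_left G a w) = metric G p v w"
    if "v \<in> tangent_space G p" "w \<in> tangent_space G p" for a p v w
    using bi_inv that unfolding bi_invariant_def by blast
  show ?thesis
    using inv[OF bracket_tangent[of j i e] E_tangent[of k e], of p]
    unfolding bracket_left_invariant[symmetric] E_left[symmetric] structure_constant_def by simp
qed

lemma structure_constant_skew: "structure_constant j i k = - structure_constant i j k"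
proof -
  have "lie_bracket G (E j) (E i) e = (\<lambda>f. (- 1) * lie_bracket G (E i) (E j) e f + 0 * lie_bracket G (E i) (E j) e f)"
    by (simp add: lie_bracket_def fun_eq_iff)
  then show ?thesis unfolding structure_constant_def
    using metric_combination[OF bracket_tangent[of i j e] bracket_tangent[of i j e] E_tangent[of k e], where a = "-1" and b = 0] by simp
qed

text \<open>
  The matrix that expresses the right translates of the frame at the unit by the left-invariant frame.
\<close>

definition right_coordinate :: "'a \<Rightarrow> 3 \<Rightarrow> 3 \<Rightarrow> real" where
  "right_coordinate q i k = metric G q (d_right G q (E i e)) (E k q)"

lemma right_field_tangent: "d_right G q (E i e) \<in> tangent_space G q"
  using d_left_right_tangent(2)[OF E_tangent[of i e], of q] by simp

lemma right_field_expansion: "d_right G q (E i e) f = (\<Sum>k\<in>UNIV. right_coordinate q i k * E k q f)"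
  unfolding right_coordinate_def by (rule frame_expansion[OF right_field_tangent])

text \<open>
  Right invariance of the metric makes both frames orthonormal, so the matrix between them is
  orthogonal.
\<close>

lemma right_coordinate_orthogonal:
  "(\<Sum>k\<in>UNIV. right_coordinate q i k * right_coordinate q j k) = (if i = j then 1 else 0)"
proof -
  have "metric G (e \<cdot> q) (d_right G q (E i e)) (d_right G q (E j e)) = metric G e (E i e) (E j e)"
    using bi_inv E_tangent unfolding bi_invariant_def by blast
  then have "(if i = j then 1 else 0) = metric G q (d_right G q (E i e)) (d_right G q (E j e))"
    by (simp add: metric_E)
  also have "\<dots> = metric G q (\<lambda>f. \<Sum>k\<in>UNIV. right_coordinate q i k * E k q f) (d_right G q (E j e))"
    by (rule arg_cong[where f = "\<lambda>v. metric G q v (d_right G q (E j e))"]) (simp add: right_field_expansion fun_eq_iff)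
  also have "\<dots> = (\<Sum>k\<in>UNIV. right_coordinate q i k * metric G q (E k q) (d_right G q (E j e)))"
    by (rule metric_sum) (simp_all add: E_tangent right_field_tangent)
  also have "\<dots> = (\<Sum>k\<in>UNIV. right_coordinate q i k * right_coordinate q j k)"
    using metric_sym[OF E_tangent right_field_tangent] by (simp add: right_coordinate_def)
  finally show ?thesis ..
qed

text \<open>
  Let \<open>A(s)\<close> be the orthogonal matrix that takes the left-invariant frame to the right-translated frame
  at the point \<open>a(s)\<close> of a curve that leaves the unit in direction \<open>E\<^sub>j\<close>. The brackets of \<open>E\<^sub>j\<close> with the
  frame are the derivative at 0 of left minus right frame, that is, of \<open>1 - A(s)\<close>. A curve of
  orthogonal matrices through the identity has a skew-symmetric derivative.
\<close>

lemma structure_constant_ad_skew: "structure_constant j i k = - structure_constant j k i"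
proof -
  obtain U \<phi> where U: "(U, \<phi>) \<in> atlas G" "e \<in> U" by (rule chart_exists)
  obtain w where w: "\<And>k. E k e = chart_tvec G (U, \<phi>) e (w k)" using E_chart[OF U] by metis
  obtain x where x: "\<And>m. smooth_at G e (x m)" "\<And>k m. E k e (x m) = (if k = m then 1 else 0)"
    using dual_functions[of e] by blast
  define a where "a s = inv_into U \<phi> (\<phi> e + s *\<^sub>R w j)" for s
  define b where "b i k s = (if i = k then 1 else 0) - right_coordinate (a s) i k" for i k s
  note der = frame_derivatives_along_line[OF U w x(1), where j = j, folded a_def]
  have a0: "a 0 = e" using U chart(5)[OF U(1)] by (simp add: a_def)
  have M: "((\<lambda>s. E k (a s) (x m)) \<longlongrightarrow> (if k = m then 1 else 0)) (at 0)" for k m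
    using has_vector_derivative_continuous[OF der(1), of k m] x(2) by (simp add: isCont_def a0)
  \<comment> \<open>Tested on the dual functions, the frames give the product of \<open>1 - A(s)\<close> with a matrix that tends
    to the identity, so that the quotient itself has the limit of the product.\<close>
  have lim: "((\<lambda>s. b i k s / s) \<longlongrightarrow> structure_constant j i k) (at 0)" for i k
  proof (rule tendsto_of_near_identity[where M = "\<lambda>k m s. E k (a s) (x m)", OF _ M])
    fix m
    define u where "u s = E i (a s) (x m) - d_right G (a s) (E i e) (x m)" for s
    have u: "u s = (\<Sum>k\<in>UNIV. b i k s * E k (a s) (x m))" for s
      unfolding u_def right_field_expansion b_def
      by (simp add: left_diff_distrib sum_subtractf if_distrib[of "\<lambda>r. r * _"] cong: if_cong)
    have u0: "u 0 = 0" by (simp add: u_def a0 d_right_def)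
    have "lie_bracket G (E j) (E i) e (x m) = (\<Sum>k\<in>UNIV. structure_constant j i k * E k e (x m))"
      unfolding structure_constant_def by (rule frame_expansion[OF bracket_tangent])
    then have c: "structure_constant j i m = E j e (\<lambda>q. E i q (x m)) - E i e (\<lambda>q. E j q (x m))"
      using x by (simp add: lie_bracket_def if_distrib[of "\<lambda>r. _ * r"] cong: if_cong)
    have "(u has_vector_derivative structure_constant j i m) (at 0)"
      unfolding c u_def by (rule has_vector_derivative_diff[OF der(1) der(2)])
    then have "((\<lambda>s. u s / s) \<longlongrightarrow> structure_constant j i m) (at 0)"
      unfolding has_real_derivative_iff_has_vector_derivative[symmetric] has_field_derivative_iff
      by (simp add: u0)
    then show "((\<lambda>s. \<Sum>k\<in>UNIV. b i k s / s * E k (a s) (x m)) \<longlongrightarrow> structure_constant j i m) (at 0)"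
      by (simp add: u sum_divide_distrib)
  qed
  have b0: "(b i k \<longlongrightarrow> 0) (at 0)" for i k
  proof -
    have "((\<lambda>s. b i k s / s * s) \<longlongrightarrow> structure_constant j i k * 0) (at 0)"
      by (rule tendsto_mult[OF lim tendsto_ident_at])
    then show ?thesis
      by (simp, elim Lim_transform_eventually) (simp add: eventually_at_filter)
  qed
  \<comment> \<open>Orthogonality of \<open>A = 1 - b\<close> says that \<open>b + b\<^sup>T = b b\<^sup>T\<close>, which is of second order.\<close>
  have "((\<lambda>s. \<Sum>m\<in>UNIV. b i m s / s * b k m s) \<longlongrightarrow> (\<Sum>m\<in>UNIV. structure_constant j i m * 0)) (at 0)"
    by (intro tendsto_sum tendsto_mult lim b0)
  moreover have "(\<Sum>m\<in>UNIV. b i m s / s * b k m s) = b i k s / s + b k i s / s" for s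
  proof -
    have "(\<Sum>m\<in>UNIV. b i m s * b k m s) = b i k s + b k i s"
      using right_coordinate_orthogonal[of "a s" i k] unfolding b_def
      by (simp add: left_diff_distrib right_diff_distrib sum_subtractf
          if_distrib[of "\<lambda>r. r * _"] if_distrib[of "\<lambda>r. _ * r"] cong: if_cong)
    then show ?thesis by (simp add: sum_divide_distrib[symmetric] add_divide_distrib[symmetric])
  qed
  ultimately have "((\<lambda>s. b i k s / s + b k i s / s) \<longlongrightarrow> 0) (at 0)" by simp
  moreover have "((\<lambda>s. b i k s / s + b k i s / s) \<longlongrightarrow> structure_constant j i k + structure_constant j k i) (at 0)"
    by (intro tendsto_add lim)
  ultimately have "structure_constant j i k + structure_constant j k i = 0"
    by (rule tendsto_unique[OF at_neq_bot, rotated -1, symmetric, THEN sym])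
  then show ?thesis by simp
qed

section \<open>The Levi-Civita connection and the cross product\<close>

text \<open>
  The Koszul formula for a frame in which the metric is constant. By the skew symmetry of the structure
  constants its three terms reduce to one.
\<close>

lemma connection_coordinates: "metric G p (D (E j) (E i) p) (E k p) = structure_constant j i k / 2"
proof -
  let ?c = structure_constant
  define \<Gamma> where "\<Gamma> j i k = metric G p (D (E j) (E i) p) (E k p)" for j i k
  have t: "\<Gamma> j i k - \<Gamma> i j k = ?c j i k" for j i k
    unfolding bracket_coordinates[of p j i k, symmetric] bracket_connection \<Gamma>_def
    using metric_combination[OF connection_tangent[of j i p] connection_tangent[of i j p] E_tangent[of k p],
      where a = 1 and b = "-1"] by simp
  have m: "\<Gamma> j i k = - \<Gamma> j k i" for j i k unfolding \<Gamma>_def by (rule connection_metric)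
  show ?thesis
    using t[of j i k] t[of i k j] t[of k j i] m[of j i k] m[of i j k] m[of k i j]
      structure_constant_ad_skew[of j i k] structure_constant_ad_skew[of i j k] structure_constant_ad_skew[of k i j]
      structure_constant_skew[of j i k] structure_constant_skew[of i k j] structure_constant_skew[of k j i]
    unfolding \<Gamma>_def[symmetric] by linarith
qed

definition bracket_scale :: real where "bracket_scale = structure_constant 1 2 3"

text \<open>
  In dimension three a totally skew-symmetric tensor is a multiple of the determinant, so the Lie
  bracket is a multiple of the cross product.
\<close>

lemma sum_structure_constant:
  "(\<Sum>i\<in>UNIV. \<Sum>j\<in>UNIV. u $ i * v $ j * structure_constant i j k) = bracket_scale * cross3 u v $ k"
proof -
  let ?c = structure_constant
  have z: "?c i i k = 0" "?c k i i = 0" "?c i k i = 0" for i k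
    using structure_constant_skew[of i i k] structure_constant_ad_skew[of k i i]
      structure_constant_skew[of i k i] structure_constant_ad_skew[of k i i] by linarith+
  have c: "?c 1 2 3 = bracket_scale" "?c 2 1 3 = - bracket_scale" "?c 2 3 1 = bracket_scale"
    "?c 3 2 1 = - bracket_scale" "?c 3 1 2 = bracket_scale" "?c 1 3 2 = - bracket_scale"
    unfolding bracket_scale_def
    using structure_constant_skew[of 2 1 3] structure_constant_ad_skew[of 2 1 3] structure_constant_skew[of 3 2 1]
      structure_constant_ad_skew[of 3 2 1] structure_constant_skew[of 1 3 2] by linarith+
  consider "k = 1" | "k = 2" | "k = 3" using exhaust_3 by blast
  then show ?thesis
    by cases (simp_all add: sum_3 z c cross3_def vector_3 algebra_simps)
qed

lemma algebra_bracket_cross: "algebra_bracket G E u v = bracket_scale *\<^sub>R cross3 u v"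
proof -
  have "algebra_bracket G E u v $ k = (\<Sum>i\<in>UNIV. \<Sum>j\<in>UNIV. u $ i * v $ j * structure_constant i j k)" for k
    by (simp add: algebra_bracket_def coords_def structure_constant_def)
  then show ?thesis by (simp add: vec_eq_iff sum_structure_constant)
qed

lemma cov_deriv_cross:
  "cov_deriv G D E I c u s =
    vector_derivative u (at s within I) + (bracket_scale / 2) *\<^sub>R cross3 (left_velocity G E I c s) (u s)"
proof -
  let ?t = "left_velocity G E I c s"
  have "(\<Sum>i\<in>UNIV. \<Sum>j\<in>UNIV. (?t $ j * u s $ i) *\<^sub>R coords G E (c s) (D (E j) (E i) (c s))) $ k =
      (\<Sum>i\<in>UNIV. \<Sum>j\<in>UNIV. ?t $ j * u s $ i * structure_constant j i k) / 2" for k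
    by (simp add: coords_def connection_coordinates sum_divide_distrib)
  moreover have "(\<Sum>i\<in>UNIV. \<Sum>j\<in>UNIV. ?t $ j * u s $ i * structure_constant j i k) =
      bracket_scale * cross3 ?t (u s) $ k" for k
    unfolding sum_structure_constant[symmetric] by (rule sum.swap)
  ultimately show ?thesis by (simp add: cov_deriv_def vec_eq_iff)
qed

end

section \<open>Natural mates of Euclidean frames\<close>

lemma pos_orthonormal_frame_cross:
  assumes "pos_orthonormal_frame x y z"
  shows "cross3 x y = z"
proof -
  define w where "w = cross3 x y"
  have o: "norm x = 1" "norm y = 1" "norm z = 1" "x \<bullet> y = 0" "x \<bullet> z = 0" "y \<bullet> z = 0"
    and d: "x \<bullet> cross3 y z > 0"
    using assms by (auto simp: pos_orthonormal_frame_def dot_cross_det)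
  have "(norm w)\<^sup>2 = 1" using norm_cross_dot[of x y] o by (simp add: w_def)
  \<comment> \<open>The vector \<open>w\<close> is a unit vector parallel to \<open>z\<close>; the orientation excludes \<open>w = - z\<close>.\<close>
  have "cross3 w z = (x \<bullet> z) *\<^sub>R y - (y \<bullet> z) *\<^sub>R x"
    unfolding w_def by (simp add: cross3_simps forall_3)
  then have "(w \<bullet> z)\<^sup>2 = 1" using norm_cross_dot[of w z] \<open>(norm w)\<^sup>2 = 1\<close> o by simp
  moreover have "w \<bullet> z = x \<bullet> cross3 y z" by (simp add: w_def cross3_simps)
  ultimately have "w \<bullet> z = 1" using d by (simp add: power2_eq_1_iff)
  moreover have "w \<bullet> w = 1" "z \<bullet> z = 1"
    using \<open>(norm w)\<^sup>2 = 1\<close> o(3) by (simp_all add: power2_norm_eq_inner norm_eq_1)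
  ultimately have "(w - z) \<bullet> (w - z) = 0" by (simp add: inner_diff inner_commute)
  then show ?thesis by (simp add: w_def)
qed

lemma pos_orthonormal_frame_rotate:
  assumes "pos_orthonormal_frame x y z"
  shows "pos_orthonormal_frame y z x"
proof -
  have "y \<bullet> cross3 z x = x \<bullet> cross3 y z" by (simp add: cross3_simps)
  then show ?thesis using assms by (auto simp: pos_orthonormal_frame_def dot_cross_det[symmetric] inner_commute)
qed

lemma smooth_on_has_vector_derivative:
  assumes "smooth_on I f" "s \<in> I"
  shows "(f has_vector_derivative vector_derivative f (at s within I)) (at s within I)"
proof -
  have "C_k_on (Suc 0) I f" using assms(1) unfolding smooth_on_def by blast
  then have "f differentiable (at s within I)" using assms(2) unfolding C_k_on.simps differentiable_def by blast
  then show ?thesis by (simp add: vector_derivative_works)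
qed

text \<open>
  Derivatives within the interval are unique because each of its points is a limit point.
\<close>

lemma at_within_interval_neq_bot:
  fixes I :: "real set"
  assumes "is_interval I" "interior I \<noteq> {}" "s \<in> I"
  shows "at s within I \<noteq> bot"
proof -
  obtain x e where e: "e > 0" "ball x e \<subseteq> I" using assms(2) by (auto simp: mem_interior)
  have "I \<noteq> {y}" for y
  proof
    assume "I = {y}"
    then have "x = y" "x + e / 2 = y" using e by (auto simp: ball_def dist_norm subset_iff)
    then show False using e by simp
  qed
  with is_interval_connected[OF assms(1)] assms(3) have "s islimpt I"
    by (rule connected_imp_perfect)
  then show ?thesis by (simp add: trivial_limit_within)
qed

text \<open>
  The Frenet equations of a curve in Euclidean space with torsion \<open>\<mu>\<close>. On a Lie group the derivative of
  coordinates takes the place of the covariant derivative, and \<open>\<mu>\<close> is the torsion minus the Lie group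
  torsion.
\<close>

definition euclidean_frenet ::
  "real set \<Rightarrow> (real \<Rightarrow> real^3) \<Rightarrow> (real \<Rightarrow> real^3) \<Rightarrow> (real \<Rightarrow> real^3) \<Rightarrow> (real \<Rightarrow> real) \<Rightarrow> (real \<Rightarrow> real) \<Rightarrow> bool"
  where
  "euclidean_frenet I T N B \<kappa> \<mu> \<longleftrightarrow> (\<forall>s\<in>I.
     \<kappa> s > 0 \<and> pos_orthonormal_frame (T s) (N s) (B s) \<and>
     (T has_vector_derivative \<kappa> s *\<^sub>R N s) (at s within I) \<and>
     (N has_vector_derivative (\<mu> s *\<^sub>R B s - \<kappa> s *\<^sub>R T s)) (at s within I) \<and>
     (B has_vector_derivative - \<mu> s *\<^sub>R N s) (at s within I))"

lemma euclidean_frenet_unique_normal: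
  assumes "euclidean_frenet I T N B \<kappa> \<mu>" "euclidean_frenet I T1 N1 B1 \<kappa>1 \<mu>1"
    and "\<And>s. s \<in> I \<Longrightarrow> T1 s = T s" and "s \<in> I" "at s within I \<noteq> bot"
  shows "N1 s = N s"
proof -
  have "(T has_vector_derivative \<kappa>1 s *\<^sub>R N1 s) (at s within I)"
    by (rule has_vector_derivative_transform[OF \<open>s \<in> I\<close>, where f = T1])
      (use assms in \<open>auto simp: euclidean_frenet_def\<close>)
  then have eq: "\<kappa>1 s *\<^sub>R N1 s = \<kappa> s *\<^sub>R N s"
    using assms vector_derivative_unique_within unfolding euclidean_frenet_def by blast
  have n: "norm (N1 s) = 1" "norm (N s) = 1" "\<kappa> s > 0" "\<kappa>1 s > 0"
    using assms by (auto simp: euclidean_frenet_def pos_orthonormal_frame_def)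
  then have "\<kappa>1 s = \<kappa> s" using arg_cong[OF eq, of norm] by simp
  then show ?thesis using eq n by simp
qed

text \<open>
  Both frames give the derivative of the same vector function, \<open>\<kappa>' N' = \<mu> B - \<kappa> T\<close>; its length is \<open>\<kappa>'\<close> and
  its direction is \<open>N'\<close>. The remaining vector is the cross product of the first two.
\<close>

lemma euclidean_natural_mate_frame:
  assumes fr: "euclidean_frenet I T N B \<kappa> \<mu>" and fr': "euclidean_frenet I T' N' B' \<kappa>' \<mu>'"
    and mate: "\<And>s. s \<in> I \<Longrightarrow> T' s = N s" and s: "s \<in> I" "at s within I \<noteq> bot"
  defines "\<omega> \<equiv> sqrt ((\<mu> s)\<^sup>2 + (\<kappa> s)\<^sup>2)"
  shows "\<kappa>' s = \<omega>"
    and "N' s = (\<mu> s *\<^sub>R B s - \<kappa> s *\<^sub>R T s) /\<^sub>R \<omega>"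
    and "B' s = (\<mu> s *\<^sub>R T s + \<kappa> s *\<^sub>R B s) /\<^sub>R \<omega>"
proof -
  have f: "pos_orthonormal_frame (T s) (N s) (B s)" "pos_orthonormal_frame (T' s) (N' s) (B' s)" "\<kappa>' s > 0"
    using fr fr' s(1) by (auto simp: euclidean_frenet_def)
  have "(N has_vector_derivative \<kappa>' s *\<^sub>R N' s) (at s within I)"
    by (rule has_vector_derivative_transform[OF s(1), where f = T'])
      (use fr' s mate in \<open>auto simp: euclidean_frenet_def\<close>)
  moreover have "(N has_vector_derivative (\<mu> s *\<^sub>R B s - \<kappa> s *\<^sub>R T s)) (at s within I)"
    using fr s(1) by (auto simp: euclidean_frenet_def)
  ultimately have eq: "\<kappa>' s *\<^sub>R N' s = \<mu> s *\<^sub>R B s - \<kappa> s *\<^sub>R T s"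
    using vector_derivative_unique_within[OF s(2)] by blast
  have o: "T s \<bullet> T s = 1" "B s \<bullet> B s = 1" "T s \<bullet> B s = 0" "norm (N' s) = 1"
    using f by (auto simp: pos_orthonormal_frame_def norm_eq_1)
  have "norm (\<mu> s *\<^sub>R B s - \<kappa> s *\<^sub>R T s) = \<omega>"
    unfolding norm_eq_sqrt_inner \<omega>_def
    using o by (simp add: inner_diff inner_commute power2_eq_square)
  then show k: "\<kappa>' s = \<omega>" using arg_cong[OF eq, of norm] o(4) f(3) by simp
  show N': "N' s = (\<mu> s *\<^sub>R B s - \<kappa> s *\<^sub>R T s) /\<^sub>R \<omega>"
    using f(3) unfolding eq[symmetric] k[symmetric] by simp
  have c: "cross3 (N s) (B s) = T s" "cross3 (N s) (T s) = - B s"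
    using pos_orthonormal_frame_cross[OF pos_orthonormal_frame_rotate[OF f(1)]]
      pos_orthonormal_frame_cross[OF f(1)] cross_skew[of "N s" "T s"] by auto
  have "B' s = cross3 (N s) (N' s)"
    using pos_orthonormal_frame_cross[OF f(2)] mate[OF s(1)] by simp
  also have "\<dots> = (\<mu> s *\<^sub>R T s + \<kappa> s *\<^sub>R B s) /\<^sub>R \<omega>"
    unfolding N' by (simp add: cross_mult_right Cross3.right_diff_distrib c)
  finally show "B' s = (\<mu> s *\<^sub>R T s + \<kappa> s *\<^sub>R B s) /\<^sub>R \<omega>" .
qed

text \<open>
  The frame vectors are known to be differentiable, and \<open>\<mu> / \<kappa> = - (N' \<bullet> B) / (N' \<bullet> T)\<close>. The quotient rule
  and the Frenet equations of both curves therefore give the derivative of \<open>\<mu> / \<kappa>\<close> without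
  differentiating \<open>\<kappa>\<close> or \<open>\<mu>\<close>.
\<close>

lemma euclidean_natural_mate_torsion:
  assumes fr: "euclidean_frenet I T N B \<kappa> \<mu>" and fr': "euclidean_frenet I T' N' B' \<kappa>' \<mu>'"
    and mate: "\<And>s. s \<in> I \<Longrightarrow> T' s = N s" and nt: "\<And>s. s \<in> I \<Longrightarrow> at s within I \<noteq> bot" and s: "s \<in> I"
  shows "((\<lambda>s. \<mu> s / \<kappa> s) has_vector_derivative \<mu>' s * (1 + (\<mu> s / \<kappa> s)\<^sup>2)) (at s within I)"
proof -
  define \<omega> where "\<omega> t = sqrt ((\<mu> t)\<^sup>2 + (\<kappa> t)\<^sup>2)" for t
  define p where "p t = N' t \<bullet> T t" for t
  define q where "q t = N' t \<bullet> B t" for t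
  have k: "\<kappa> t > 0" if "t \<in> I" for t using fr that by (auto simp: euclidean_frenet_def)
  have \<omega>: "\<omega> t > 0" if "t \<in> I" for t using k[OF that] by (simp add: \<omega>_def sum_power2_gt_zero_iff)
  have o: "T t \<bullet> T t = 1" "B t \<bullet> B t = 1" "T t \<bullet> B t = 0" "N t \<bullet> T t = 0" "N t \<bullet> B t = 0" "N' t \<bullet> T' t = 0" if "t \<in> I" for t
    using fr fr' that by (auto simp: euclidean_frenet_def pos_orthonormal_frame_def norm_eq_1 inner_commute)
  have frame: "N' t = (\<mu> t *\<^sub>R B t - \<kappa> t *\<^sub>R T t) /\<^sub>R \<omega> t"
    "B' t = (\<mu> t *\<^sub>R T t + \<kappa> t *\<^sub>R B t) /\<^sub>R \<omega> t" if "t \<in> I" for t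
    using euclidean_natural_mate_frame[OF fr fr' mate that nt[OF that]] by (simp_all add: \<omega>_def)
  have pq: "p t = - \<kappa> t / \<omega> t" "q t = \<mu> t / \<omega> t" if "t \<in> I" for t
    unfolding p_def q_def frame(1)[OF that]
    using o[OF that] \<omega>[OF that] by (simp_all add: inner_diff inner_commute divide_inverse)
  have H: "\<mu> t / \<kappa> t = - q t / p t" if "t \<in> I" for t
    using pq[OF that] k[OF that] \<omega>[OF that] by simp
  have d: "(T has_vector_derivative \<kappa> s *\<^sub>R N s) (at s within I)"
    "(B has_vector_derivative - \<mu> s *\<^sub>R N s) (at s within I)"
    "(N' has_vector_derivative (\<mu>' s *\<^sub>R B' s - \<kappa>' s *\<^sub>R T' s)) (at s within I)"
    using fr fr' s by (auto simp: euclidean_frenet_def)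
  have B': "B' s \<bullet> T s = \<mu> s / \<omega> s" "B' s \<bullet> B s = \<kappa> s / \<omega> s"
    unfolding frame(2)[OF s] using o[OF s] by (simp_all add: inner_add inner_commute divide_inverse)
  have "(p has_vector_derivative \<mu>' s * (\<mu> s / \<omega> s)) (at s within I)"
    unfolding p_def
    using bounded_bilinear.has_vector_derivative[OF bounded_bilinear_inner d(3) d(1)] o[OF s] B' mate[OF s]
    by (simp add: inner_diff_left)
  moreover have "(q has_vector_derivative \<mu>' s * (\<kappa> s / \<omega> s)) (at s within I)"
    unfolding q_def
    using bounded_bilinear.has_vector_derivative[OF bounded_bilinear_inner d(3) d(2)] o[OF s] B' mate[OF s]
    by (simp add: inner_diff_left)
  ultimately have "((\<lambda>t. - q t / p t) has_real_derivative
      (- (\<mu>' s * (\<kappa> s / \<omega> s)) * p s - (- q s) * (\<mu>' s * (\<mu> s / \<omega> s))) / (p s * p s)) (at s within I)"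
    using pq[OF s] k[OF s] \<omega>[OF s]
    by (intro DERIV_divide DERIV_minus) (auto simp: has_real_derivative_iff_has_vector_derivative)
  also have "(- (\<mu>' s * (\<kappa> s / \<omega> s)) * p s - (- q s) * (\<mu>' s * (\<mu> s / \<omega> s))) / (p s * p s) =
      \<mu>' s * (1 + (\<mu> s / \<kappa> s)\<^sup>2)"
    unfolding pq[OF s] using k[OF s] \<omega>[OF s] by (simp add: field_simps power2_eq_square)
  finally have "((\<lambda>t. - q t / p t) has_vector_derivative \<mu>' s * (1 + (\<mu> s / \<kappa> s)\<^sup>2)) (at s within I)"
    unfolding has_real_derivative_iff_has_vector_derivative .
  then show ?thesis by (rule has_vector_derivative_transform[OF s, rotated]) (simp add: H)
qed

section \<open>Natural mates on a Lie group\<close>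

context bi_invariant_group3
begin

text \<open>
  The covariant derivative adds half of \<open>bracket_scale\<close> times the cross product with \<open>T\<close>. This term
  vanishes for \<open>T\<close> and turns \<open>N\<close> into \<open>B\<close> and \<open>B\<close> into \<open>- N\<close>, so its only effect is to shift the torsion
  by a constant, which is the Lie group torsion.
\<close>

lemma frenet_apparatus_euclidean:
  assumes "frenet_apparatus G D E I c T N B \<kappa> \<tau>"
  shows "euclidean_frenet I T N B \<kappa> (\<lambda>s. \<tau> s - bracket_scale / 2)"
    and "s \<in> I \<Longrightarrow> lie_torsion G E T N B s = bracket_scale / 2"
proof -
  let ?b = "bracket_scale / 2"
  have *: "\<kappa> s > 0 \<and> pos_orthonormal_frame (T s) (N s) (B s) \<and>
      (T has_vector_derivative \<kappa> s *\<^sub>R N s) (at s within I) \<and>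
      (N has_vector_derivative ((\<tau> s - ?b) *\<^sub>R B s - \<kappa> s *\<^sub>R T s)) (at s within I) \<and>
      (B has_vector_derivative - (\<tau> s - ?b) *\<^sub>R N s) (at s within I) \<and>
      lie_torsion G E T N B s = ?b" if s: "s \<in> I" for s
  proof -
    have smooth: "smooth_on I T" "smooth_on I N" "smooth_on I B"
      using assms unfolding frenet_apparatus_def by blast+
    have T: "left_velocity G E I c s = T s"
      and k: "\<kappa> s > 0" and f: "pos_orthonormal_frame (T s) (N s) (B s)"
      and cov: "cov_deriv G D E I c T s = \<kappa> s *\<^sub>R N s"
        "cov_deriv G D E I c N s = - \<kappa> s *\<^sub>R T s + \<tau> s *\<^sub>R B s"
        "cov_deriv G D E I c B s = - \<tau> s *\<^sub>R N s"
      using assms s unfolding frenet_apparatus_def by metis+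
    have c: "cross3 (T s) (N s) = B s" "cross3 (T s) (B s) = - N s"
      using pos_orthonormal_frame_cross[OF f] cross_skew[of "T s" "B s"]
        pos_orthonormal_frame_cross[OF pos_orthonormal_frame_rotate[OF pos_orthonormal_frame_rotate[OF f]]] by auto
    have "vector_derivative T (at s within I) = \<kappa> s *\<^sub>R N s"
      using cov(1) unfolding cov_deriv_cross T by simp
    moreover have "vector_derivative N (at s within I) = (\<tau> s - ?b) *\<^sub>R B s - \<kappa> s *\<^sub>R T s"
      using cov(2) unfolding cov_deriv_cross T c by (simp add: algebra_simps eq_diff_eq)
    moreover have "vector_derivative B (at s within I) = - (\<tau> s - ?b) *\<^sub>R N s"
      using cov(3) unfolding cov_deriv_cross T c by (simp add: algebra_simps eq_diff_eq)
    moreover have "lie_torsion G E T N B s = ?b"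
      using f unfolding lie_torsion_def algebra_bracket_cross c
      by (simp add: pos_orthonormal_frame_def norm_eq_1)
    ultimately show ?thesis
      using k f smooth[THEN smooth_on_has_vector_derivative[OF _ s]] by simp
  qed
  then show "euclidean_frenet I T N B \<kappa> (\<lambda>s. \<tau> s - ?b)" unfolding euclidean_frenet_def by blast
  show "s \<in> I \<Longrightarrow> lie_torsion G E T N B s = ?b" using * by blast
qed

end

lemma ratio_darboux_sigma:
  fixes \<kappa> H d :: real
  assumes "\<kappa> > 0"
  shows "\<kappa> * sqrt (1 + H\<^sup>2) / (\<kappa> * (H\<^sup>2 + 1) powr (3/2) / d) = d / (1 + H\<^sup>2)"
proof -
  have pos: "1 + H\<^sup>2 > 0" by (rule add_pos_nonneg) simp_all
  have "(1 + H\<^sup>2) powr (3/2) = (1 + H\<^sup>2) powr (1 + 1/2)" by simp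
  also have "\<dots> = (1 + H\<^sup>2) * sqrt (1 + H\<^sup>2)"
    unfolding powr_add using pos by (simp add: powr_half_sqrt)
  finally have "(H\<^sup>2 + 1) powr (3/2) = (1 + H\<^sup>2) * sqrt (1 + H\<^sup>2)" by (simp add: add.commute)
  moreover have "\<kappa> * r / (\<kappa> * (w * r) / d) = d / w" if "r > 0" "w > 0" for r w :: real
    using that assms by simp
  ultimately show ?thesis using pos by simp
qed

theorem theorem3p1:
  fixes G :: "'g::{t2_space, second_countable_topology} riemannian_group"
    and D :: "'g vfield \<Rightarrow> 'g vfield \<Rightarrow> 'g vfield"
    and E :: "3 \<Rightarrow> 'g vfield"
    and I :: "real set"
    and \<gamma> \<beta> :: "real \<Rightarrow> 'g"
    and T N B T' N' B' :: "real \<Rightarrow> real^3"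
    and \<kappa> \<tau> \<kappa>' \<tau>' :: "real \<Rightarrow> real"
  assumes "lie_group_3 G" "riemannian_metric G" "bi_invariant G" "levi_civita G D"
    and "orthonormal_left_invariant_basis G E"
    and "is_interval I" "interior I \<noteq> {}"
    and "frenet_curve G D E I \<gamma> T N B \<kappa> \<tau>"
    and "frenet_apparatus G D E I \<beta> T' N' B' \<kappa>' \<tau>'"
  shows "natural_mate G D E I \<gamma> \<beta> \<longleftrightarrow>
    (let \<tau>G = lie_torsion G E T N B;
         \<tau>G' = lie_torsion G E T' N' B';
         H = harmonic_curvature \<kappa> \<tau> \<tau>G;
         H' = harmonic_curvature_deriv I \<kappa> \<tau> \<tau>G;
         \<Omega> = darboux_vec T B \<kappa> \<tau> \<tau>G;
         \<Omega>s = darboux_vec_star T B \<kappa> \<tau> \<tau>G;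
         \<omega> = darboux_norm \<kappa> \<tau> \<tau>G;
         \<sigma> = sigma_fun I \<kappa> \<tau> \<tau>G
     in \<forall>s\<in>I.
          T' s = N s \<and>
          N' s = \<Omega>s s /\<^sub>R \<omega> s \<and>
          B' s = \<Omega> s /\<^sub>R \<omega> s \<and>
          \<kappa>' s = \<omega> s \<and> \<omega> s = \<kappa> s * sqrt (1 + (H s)\<^sup>2) \<and>
          \<tau>' s - \<tau>G' s = \<omega> s / \<sigma> s \<and> \<omega> s / \<sigma> s = H' s / (1 + (H s)\<^sup>2))"
    (is "_ \<longleftrightarrow> ?rhs")
proof -
  interpret bi_invariant_group3 G D E
    using assms(1-5) by unfold_locales
  have app: "frenet_apparatus G D E I \<gamma> T N B \<kappa> \<tau>"
    using assms(8) by (simp add: frenet_curve_def)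
  define b where "b = bracket_scale / 2"
  note fr = frenet_apparatus_euclidean[OF app, folded b_def]
  note fr' = frenet_apparatus_euclidean[OF assms(9), folded b_def]
  note nt = at_within_interval_neq_bot[OF assms(6,7)]
  show ?thesis
  proof
    assume ?rhs
    then have "\<forall>s\<in>I. T' s = N s" by (simp add: Let_def)
    with app assms(9) show "natural_mate G D E I \<gamma> \<beta>" unfolding natural_mate_def by blast
  next
    assume "natural_mate G D E I \<gamma> \<beta>"
    then obtain T1 N1 B1 \<kappa>1 \<tau>1 T2 N2 B2 \<kappa>2 \<tau>2 where
      app1: "frenet_apparatus G D E I \<gamma> T1 N1 B1 \<kappa>1 \<tau>1" and
      app2: "frenet_apparatus G D E I \<beta> T2 N2 B2 \<kappa>2 \<tau>2" and T2: "\<forall>s\<in>I. T2 s = N1 s"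
      unfolding natural_mate_def by blast
    have "T1 s = T s" "T2 s = T' s" if "s \<in> I" for s
      using that app app1 app2 assms(9) by (simp_all add: frenet_apparatus_def)
    then have mate: "T' s = N s" if "s \<in> I" for s
      using euclidean_frenet_unique_normal[OF fr(1) frenet_apparatus_euclidean(1)[OF app1], of s] nt that T2
      by simp
    let ?\<mu> = "\<lambda>s. \<tau> s - b"
    show ?rhs unfolding Let_def
    proof
      fix s assume s: "s \<in> I"
      let ?H = "harmonic_curvature \<kappa> \<tau> (lie_torsion G E T N B)"
      let ?\<omega> = "darboux_norm \<kappa> \<tau> (lie_torsion G E T N B) s"
      have k: "\<kappa> s > 0" using fr(1) s unfolding euclidean_frenet_def by blast
      have H: "?H t = ?\<mu> t / \<kappa> t" if "t \<in> I" for t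
        using fr(2)[OF that] by (simp add: harmonic_curvature_def)
      have \<omega>: "?\<omega> = sqrt ((?\<mu> s)\<^sup>2 + (\<kappa> s)\<^sup>2)" using fr(2)[OF s] by (simp add: darboux_norm_def)
      have frame: "\<kappa>' s = ?\<omega>" "N' s = (?\<mu> s *\<^sub>R B s - \<kappa> s *\<^sub>R T s) /\<^sub>R ?\<omega>"
        "B' s = (?\<mu> s *\<^sub>R T s + \<kappa> s *\<^sub>R B s) /\<^sub>R ?\<omega>"
        using euclidean_natural_mate_frame[OF fr(1) fr'(1) _ s nt[OF s]] mate unfolding \<omega> by blast+
      have "(?H has_vector_derivative (\<tau>' s - b) * (1 + (?\<mu> s / \<kappa> s)\<^sup>2)) (at s within I)"
        by (rule has_vector_derivative_transform[OF s _ euclidean_natural_mate_torsion[OF fr(1) fr'(1) mate nt s]])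
          (simp_all add: H)
      then have H': "harmonic_curvature_deriv I \<kappa> \<tau> (lie_torsion G E T N B) s = (\<tau>' s - b) * (1 + (?H s)\<^sup>2)"
        unfolding harmonic_curvature_deriv_def H[OF s] by (rule vector_derivative_within[OF nt[OF s]])
      have "?\<omega> = sqrt ((\<kappa> s)\<^sup>2 * (1 + (?H s)\<^sup>2))"
        unfolding \<omega> H[OF s] using k by (simp add: field_simps)
      then have \<omega>H: "?\<omega> = \<kappa> s * sqrt (1 + (?H s)\<^sup>2)" using k by (simp add: real_sqrt_mult)
      have \<sigma>: "?\<omega> / sigma_fun I \<kappa> \<tau> (lie_torsion G E T N B) s =
          harmonic_curvature_deriv I \<kappa> \<tau> (lie_torsion G E T N B) s / (1 + (?H s)\<^sup>2)"
        unfolding \<omega>H sigma_fun_def by (rule ratio_darboux_sigma[OF k])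
      have pos: "1 + (?H s)\<^sup>2 \<noteq> 0" using zero_le_power2[of "?H s"] by linarith
      have "\<tau>' s - lie_torsion G E T' N' B' s = ?\<omega> / sigma_fun I \<kappa> \<tau> (lie_torsion G E T N B) s"
        unfolding \<sigma> H' fr'(2)[OF s] using pos by simp
      moreover have "N' s = darboux_vec_star T B \<kappa> \<tau> (lie_torsion G E T N B) s /\<^sub>R ?\<omega>"
        unfolding frame(2) darboux_vec_star_def fr(2)[OF s] by simp
      moreover have "B' s = darboux_vec T B \<kappa> \<tau> (lie_torsion G E T N B) s /\<^sub>R ?\<omega>"
        unfolding frame(3) darboux_vec_def fr(2)[OF s] by simp
      ultimately show "T' s = N s \<and>
          N' s = darboux_vec_star T B \<kappa> \<tau> (lie_torsion G E T N B) s /\<^sub>R ?\<omega> \<and>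
          B' s = darboux_vec T B \<kappa> \<tau> (lie_torsion G E T N B) s /\<^sub>R ?\<omega> \<and>
          \<kappa>' s = ?\<omega> \<and> ?\<omega> = \<kappa> s * sqrt (1 + (?H s)\<^sup>2) \<and>
          \<tau>' s - lie_torsion G E T' N' B' s = ?\<omega> / sigma_fun I \<kappa> \<tau> (lie_torsion G E T N B) s \<and>
          ?\<omega> / sigma_fun I \<kappa> \<tau> (lie_torsion G E T N B) s =
            harmonic_curvature_deriv I \<kappa> \<tau> (lie_torsion G E T N B) s / (1 + (?H s)\<^sup>2)"
        using mate[OF s] frame(1) \<omega>H \<sigma> by blast
    qed
  qed
qed

end
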